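(* Let $X,Y,Z$ be represented spaces and let $f:\subseteq X\rightrightarrows Y$ and $g:\subseteq Y\rightrightarrows Z$ be multi-valued functions. If $f\leq_{\mathrm W}\widehat{\mathsf{LLPO}}$ and $g\leq_{\mathrm W}\widehat{\mathsf{LLPO}}$, then $g\circ f\leq_{\mathrm W}\widehat{\mathsf{LLPO}}$. The same holds true with respect to some oracle, i.e. when Weihrauch reducibility is replaced in all three occurrences by its continuous counterpart, in which the reduction functions $H,K$ are only required to be continuous.
   Context: A represented space $(X,\delta_X)$ is a set $X$ with a surjective partial map $\delta_X:\subseteq\mathbb{N}^{\mathbb{N}}\to X$. A multi-valued function $f:\subseteq X\rightrightarrows Y$ assigns to each $x$ a set $f(x)\subseteq Y$, with $\mathrm{dom}(f)=\{x: f(x)\neq\emptyset\}$. A realizer of $f$ is a partial $F:\subseteq\mathbb{N}^{\mathbb{N}}\to\mathbb{N}^{\mathbb{N}}$ such that $F(p)$ is defined and $\delta_YF(p)\in f(\delta_X(p))$ whenever $\delta_X(p)\in\mathrm{dom}(f)$. $f\leq_{\mathrm W}g$ iff there are computable $H,K:\subseteq\mathbb{N}^{\mathbb{N}}\to\mathbb{N}^{\mathbb{N}}$ such that for every realizer $G$ of $g$ the function $p\mapsto H\langle p,GK(p)\rangle$ is a realizer of $f$, where $\langle\cdot,\cdot\rangle$ is a computable pairing on $\mathbb{N}^{\mathbb{N}}$. Composition of multi-valued functions: $\mathrm{dom}(g\circ f)=\{x\in\mathrm{dom}(f): f(x)\subseteq\mathrm{dom}(g)\}$ and $(g\circ f)(x)=\{z:(\exists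 y\in f(x))\,z\in g(y)\}$ for such $x$. $\mathsf{LLPO}:\subseteq\mathbb{N}^{\mathbb{N}}\rightrightarrows\mathbb{N}$ has domain $\{p: p(k)\neq0\text{ for at most one }k\}$ and values in $\{0,1\}$, with $0\in\mathsf{LLPO}(p)\iff(\forall n)\,p(2n)=0$ and $1\in\mathsf{LLPO}(p)\iff(\forall n)\,p(2n+1)=0$. Its parallelization, regarded as a map $\widehat{\mathsf{LLPO}}:\subseteq\mathbb{N}^{\mathbb{N}}\rightrightarrows\mathbb{N}^{\mathbb{N}}$, is $\widehat{\mathsf{LLPO}}\langle p_0,p_1,\dots\rangle=\{q:(\forall k)\,q(k)\in\mathsf{LLPO}(p_k)\}$, defined when all $p_k\in\mathrm{dom}(\mathsf{LLPO})$, where $\langle p_0,p_1,\dots\rangle\langle k,n\rangle=p_k(n)$. $\mathbb{N}^{\mathbb{N}}$ is represented by the identity. *)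

theory Defs
  imports "HOL-Analysis.Analysis" "HOL-Library.Nat_Bijection"
begin

type_synonym baire = "nat \<Rightarrow> nat"

section \<open>Computable and continuous partial functions on Baire space\<close>

text \<open>
  Programs for partial recursive functions with an oracle \<open>p\<close>: the constant 0, successor,
  projections and the oracle, closed under composition, primitive recursion and unbounded
  minimisation.  Arguments are lists, and surplus arguments are ignored by the basic functions.
\<close>

datatype recf =
    RZero
  | RSucc
  | RProj nat
  | ROracle
  | RComp recf "recf list"
  | RPrim recf recf
  | RMin recf

fun run :: "recf \<Rightarrow> baire \<Rightarrow> nat list \<Rightarrow> nat option" where
  "run RZero p xs = Some 0"
| "run RSucc p xs = (case xs of [] \<Rightarrow> None | x # _ \<Rightarrow> Some (Suc x))"
| "run (RProj i) p xs = (if i < length xs then Some (xs ! i) else None)"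
| "run ROracle p xs = (case xs of [] \<Rightarrow> None | x # _ \<Rightarrow> Some (p x))"
| "run (RComp g fs) p xs =
     (let ys = map (\<lambda>f. run f p xs) fs
      in if None \<in> set ys then None else run g p (map the ys))"
| "run (RPrim f g) p xs =
     (case xs of
        [] \<Rightarrow> None
      | n # zs \<Rightarrow>
          rec_nat (run f p zs) (\<lambda>m r. Option.bind r (\<lambda>v. run g p (m # v # zs))) n)"
| "run (RMin f) p xs =
     (if \<exists>y. run f p (y # xs) = Some 0 \<and> (\<forall>z<y. run f p (z # xs) \<noteq> None)
      then Some (LEAST y. run f p (y # xs) = Some 0)
      else None)"

text \<open>
  As usual for partial functions on Baire space, the program has to produce the value on the
  domain of \<open>F\<close>; nothing is required outside of it.
\<close>

definition computable :: "(baire \<rightharpoonup> baire) \<Rightarrow> bool" where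
  "computable F \<longleftrightarrow> (\<exists>e. \<forall>p q. F p = Some q \<longrightarrow> (\<forall>n. run e p [n] = Some (q n)))"

text \<open>Continuity refers to the product topology on \<^typ>\<open>baire\<close>, where \<^typ>\<open>nat\<close> is discrete.\<close>

definition continuous_partial :: "(baire \<rightharpoonup> baire) \<Rightarrow> bool" where
  "continuous_partial F \<longleftrightarrow> continuous_on (dom F) (\<lambda>p. the (F p))"

definition baire_pair :: "baire \<Rightarrow> baire \<Rightarrow> baire" where
  "baire_pair p q = (\<lambda>n. if even n then p (n div 2) else q (n div 2))"

section \<open>Represented spaces and multi-valued functions\<close>

definition represented_space :: "'a set \<Rightarrow> (baire \<rightharpoonup> 'a) \<Rightarrow> bool" where
  "represented_space X \<delta> \<longleftrightarrow> ran \<delta> = X"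

text \<open>
  A partial multi-valued function is a set-valued function; its domain consists of the points
  with nonempty value, so the value is empty outside of the source set.
\<close>

definition mdom :: "('a \<Rightarrow> 'b set) \<Rightarrow> 'a set" where
  "mdom f = {x. f x \<noteq> {}}"

definition multivalued :: "('a \<Rightarrow> 'b set) \<Rightarrow> 'a set \<Rightarrow> 'b set \<Rightarrow> bool" where
  "multivalued f X Y \<longleftrightarrow> mdom f \<subseteq> X \<and> (\<forall>x\<in>X. f x \<subseteq> Y)"

definition mcomp :: "('b \<Rightarrow> 'c set) \<Rightarrow> ('a \<Rightarrow> 'b set) \<Rightarrow> 'a \<Rightarrow> 'c set" where
  "mcomp g f x = (if x \<in> mdom f \<and> f x \<subseteq> mdom g then {z. \<exists>y\<in>f x. z \<in> g y} else {})"

section \<open>Weihrauch reducibility\<close>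

definition realizer ::
  "(baire \<rightharpoonup> 'a) \<Rightarrow> (baire \<rightharpoonup> 'b) \<Rightarrow> ('a \<Rightarrow> 'b set) \<Rightarrow> (baire \<rightharpoonup> baire) \<Rightarrow> bool" where
  "realizer \<delta>X \<delta>Y f F \<longleftrightarrow>
     (\<forall>p x. \<delta>X p = Some x \<and> x \<in> mdom f \<longrightarrow>
        (\<exists>q y. F p = Some q \<and> \<delta>Y q = Some y \<and> y \<in> f x))"

text \<open>The parameter \<open>C\<close> is the class of admissible reduction functions \<open>H\<close> and \<open>K\<close>.\<close>

definition reducible_via ::
  "((baire \<rightharpoonup> baire) \<Rightarrow> bool) \<Rightarrow>
   (baire \<rightharpoonup> 'a) \<Rightarrow> (baire \<rightharpoonup> 'b) \<Rightarrow> ('a \<Rightarrow> 'b set) \<Rightarrow>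
   (baire \<rightharpoonup> 'c) \<Rightarrow> (baire \<rightharpoonup> 'd) \<Rightarrow> ('c \<Rightarrow> 'd set) \<Rightarrow> bool" where
  "reducible_via C \<delta>X \<delta>Y f \<delta>U \<delta>V g \<longleftrightarrow>
     (\<exists>H K. C H \<and> C K \<and>
        (\<forall>G. realizer \<delta>U \<delta>V g G \<longrightarrow>
           realizer \<delta>X \<delta>Y f
             (\<lambda>p. Option.bind (K p) (\<lambda>r. Option.bind (G r) (\<lambda>q. H (baire_pair p q))))))"

abbreviation weihrauch_le where
  "weihrauch_le \<equiv> reducible_via computable"

abbreviation weihrauch_le_continuous where
  "weihrauch_le_continuous \<equiv> reducible_via continuous_partial"

section \<open>The parallelization of LLPO\<close>

definition LLPO :: "baire \<Rightarrow> nat set" where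
  "LLPO p =
     (if \<forall>i j. p i \<noteq> 0 \<and> p j \<noteq> 0 \<longrightarrow> i = j
      then {v. v = 0 \<and> (\<forall>n. p (2 * n) = 0) \<or> v = 1 \<and> (\<forall>n. p (2 * n + 1) = 0)}
      else {})"

text \<open>
  The argument is read as a countable tuple with \<open>k\<close>-th component
  \<open>\<lambda>n. r (prod_encode (k, n))\<close>.  The value is empty as soon as one component lies outside
  of the domain of \<^const>\<open>LLPO\<close>.
\<close>

definition LLPO_hat :: "baire \<Rightarrow> baire set" where
  "LLPO_hat r = {q. \<forall>k. q k \<in> LLPO (\<lambda>n. r (prod_encode (k, n)))}"

definition baire_rep :: "baire \<rightharpoonup> baire" where
  "baire_rep = Some"

end

theory Submission imports Defs begin

text \<open>
  A reduction of \<open>f\<close> to \<^const>\<open>LLPO_hat\<close> turns a name \<open>p\<close> into an instance \<open>r\<close> whose solutions form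
  a nonempty set of \<open>0\<close>-\<open>1\<close>-sequences that is closed effectively in \<open>p\<close>: a sequence that fails to
  solve \<open>r\<close> is refuted by one nonzero entry of \<open>r\<close>.  For the composition, the right object is the
  set of pairs \<open>(q, q')\<close> where \<open>q\<close> solves the instance of \<open>f\<close> and \<open>q'\<close> solves the instance of \<open>g\<close>
  that is computed from \<open>p\<close> and \<open>q\<close>.  The second instance exists only if \<open>q\<close> really is a solution of
  the first one, so the reduction functions cannot be run to completion on a finite piece of \<open>q\<close>.
  They can be run for a bounded time on finite information, however: whatever is produced for a
  true solution is correct, and everything is produced eventually.  Hence the set of pairs is again
  given by finite refutations (\<open>not_refuted\<close>, \<open>solution_if_not_refuted\<close>).

  It remains to find an unrefuted sequence with the help of \<^const>\<open>LLPO_hat\<close>, which is weak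
  Koenig's lemma.  At every node of the binary tree, \<^const>\<open>LLPO\<close> is asked which of the two subtrees
  does not die first.  If the node has an infinite path above it, then so has the child that
  the answer selects, because a child that dies while its sibling is alive is detected and
  excluded; following the answers from the root therefore yields an unrefuted sequence
  (\<open>refutation_tree.branch_unrefuted\<close>).

  This argument uses only a few properties of the class of reduction functions, which are
  collected in the locale \<open>reduction_class\<close>.  For continuous functions they are easy.  For
  computable functions the point is that the instance of weak Koenig's lemma is
  computable, and for this the bounded evaluation of a program on partial information has
  to be computable itself (\<open>total_rec_ev\<close>).
\<close>

section \<open>Total recursive functionals\<close>

text \<open>
  The argument lists have a fixed length, so that primitive recursion and composition can rely
  on it; programs may behave arbitrarily on lists of other lengths.
\<close>

definition total_rec :: "nat \<Rightarrow> (baire \<Rightarrow> nat list \<Rightarrow> nat) \<Rightarrow> bool" where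
  "total_rec k \<Phi> \<longleftrightarrow> (\<exists>e. \<forall>p xs. length xs = k \<longrightarrow> run e p xs = Some (\<Phi> p xs))"

lemma total_rec_cong:
  assumes "total_rec k \<Phi>" "\<And>p xs. length xs = k \<Longrightarrow> \<Phi> p xs = \<Psi> p xs"
  shows "total_rec k \<Psi>"
  using assms unfolding total_rec_def by metis

lemma total_rec_compose:
  assumes "total_rec (length \<Phi>s) \<Psi>" and "\<And>\<Phi>. \<Phi> \<in> set \<Phi>s \<Longrightarrow> total_rec k \<Phi>"
  shows "total_rec k (\<lambda>p xs. \<Psi> p (map (\<lambda>\<Phi>. \<Phi> p xs) \<Phi>s))"
proof -
  obtain e where e: "\<And>p xs. length xs = length \<Phi>s \<Longrightarrow> run e p xs = Some (\<Psi> p xs)"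
    using assms(1) unfolding total_rec_def by blast
  have "\<forall>\<Phi>. \<exists>d. \<Phi> \<in> set \<Phi>s \<longrightarrow> (\<forall>p xs. length xs = k \<longrightarrow> run d p xs = Some (\<Phi> p xs))"
    using assms(2) unfolding total_rec_def by blast
  then obtain d where d: "\<And>\<Phi> p xs. \<Phi> \<in> set \<Phi>s \<Longrightarrow> length xs = k \<Longrightarrow> run (d \<Phi>) p xs = Some (\<Phi> p xs)"
    by metis
  have "run (RComp e (map d \<Phi>s)) p xs = Some (\<Psi> p (map (\<lambda>\<Phi>. \<Phi> p xs) \<Phi>s))"
    if "length xs = k" for p xs
  proof -
    have ys: "map (\<lambda>f. run f p xs) (map d \<Phi>s) = map Some (map (\<lambda>\<Phi>. \<Phi> p xs) \<Phi>s)"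
      using d that by simp
    have "None \<notin> set (map Some (map (\<lambda>\<Phi>. \<Phi> p xs) \<Phi>s))"
      by auto
    then show ?thesis
      unfolding run.simps Let_def ys by (auto simp: e comp_def)
  qed
  then show ?thesis
    unfolding total_rec_def by blast
qed

text \<open>
  The conclusions of the next three rules are not higher-order patterns, so they have to be used
  with an explicit instantiation of \<open>F\<close>.
\<close>

lemma total_rec_comp1:
  assumes "total_rec 1 (\<lambda>p ys. F p (ys ! 0))" "total_rec k a"
  shows "total_rec k (\<lambda>p xs. F p (a p xs))"
  using total_rec_compose[of "[a]" "\<lambda>p ys. F p (ys ! 0)" k] assms by simp

lemma total_rec_comp2:
  assumes "total_rec 2 (\<lambda>p ys. F p (ys ! 0) (ys ! 1))" "total_rec k a" "total_rec k b"
  shows "total_rec k (\<lambda>p xs. F p (a p xs) (b p xs))"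
  using total_rec_compose[of "[a, b]" "\<lambda>p ys. F p (ys ! 0) (ys ! 1)" k] assms
  by (auto simp: numeral_2_eq_2)

lemma total_rec_comp3:
  assumes "total_rec 3 (\<lambda>p ys. F p (ys ! 0) (ys ! 1) (ys ! 2))"
    "total_rec k a" "total_rec k b" "total_rec k c"
  shows "total_rec k (\<lambda>p xs. F p (a p xs) (b p xs) (c p xs))"
  using total_rec_compose[of "[a, b, c]" "\<lambda>p ys. F p (ys ! 0) (ys ! 1) (ys ! 2)" k] assms
  by (auto simp: numeral_3_eq_3 numeral_2_eq_2)

lemma total_rec_nth: "i < k \<Longrightarrow> total_rec k (\<lambda>p xs. xs ! i)"
  unfolding total_rec_def by (intro exI[of _ "RProj i"]) auto

text \<open>
  The rules for recursion, sums and bounded quantifiers push the bound variables onto the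
  argument list; the old arguments are then found in its tail.
\<close>

lemma total_rec_nth_tl: "Suc i < k \<Longrightarrow> total_rec k (\<lambda>p xs. tl xs ! i)"
  by (rule total_rec_cong[OF total_rec_nth[of "Suc i"]]) (auto simp: nth_tl)

lemma total_rec_nth_tl_tl: "Suc (Suc i) < k \<Longrightarrow> total_rec k (\<lambda>p xs. tl (tl xs) ! i)"
  by (rule total_rec_cong[OF total_rec_nth[of "Suc (Suc i)"]]) (auto simp: nth_tl)

lemma total_rec_Suc:
  assumes "total_rec k a" shows "total_rec k (\<lambda>p xs. Suc (a p xs))"
proof (rule total_rec_comp1[where F = "\<lambda>p. Suc", OF _ assms])
  show "total_rec 1 (\<lambda>p ys. Suc (ys ! 0))"
    unfolding total_rec_def by (intro exI[of _ RSucc]) (auto split: list.split)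
qed

lemma total_rec_oracle:
  assumes "total_rec k a" shows "total_rec k (\<lambda>p xs. p (a p xs))"
proof (rule total_rec_comp1[where F = "\<lambda>p. p", OF _ assms])
  show "total_rec 1 (\<lambda>p ys. p (ys ! 0))"
    unfolding total_rec_def by (intro exI[of _ ROracle]) (auto split: list.split)
qed

lemma total_rec_const: "total_rec k (\<lambda>p xs. c)"
proof (induction c)
  case 0
  show ?case unfolding total_rec_def by (intro exI[of _ RZero]) auto
next
  case (Suc c)
  then show ?case by (rule total_rec_Suc)
qed

lemma total_rec_prim:
  assumes A: "total_rec k A" and B: "total_rec (Suc (Suc k)) (\<lambda>p ys. B p (ys ! 0) (ys ! 1) (tl (tl ys)))"
    and N: "total_rec k N"
  shows "total_rec k (\<lambda>p xs. rec_nat (A p xs) (\<lambda>m v. B p m v xs) (N p xs))"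
proof -
  obtain a where a: "\<And>p xs. length xs = k \<Longrightarrow> run a p xs = Some (A p xs)"
    using A unfolding total_rec_def by blast
  obtain b where b: "\<And>p ys. length ys = Suc (Suc k) \<Longrightarrow>
      run b p ys = Some (B p (ys ! 0) (ys ! 1) (tl (tl ys)))"
    using B unfolding total_rec_def by blast
  have rec: "rec_nat (run a p xs) (\<lambda>m r. Option.bind r (\<lambda>v. run b p (m # v # xs))) n =
      Some (rec_nat (A p xs) (\<lambda>m v. B p m v xs) n)" if "length xs = k" for p xs n
    using that by (induction n) (auto simp: a b)
  have "total_rec (Suc k) (\<lambda>p ys. rec_nat (A p (tl ys)) (\<lambda>m v. B p m v (tl ys)) (hd ys))"
    unfolding total_rec_def
    by (intro exI[of _ "RPrim a b"]) (auto simp: rec length_Suc_conv split: list.split)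
  moreover have "total_rec k \<Phi>" if "\<Phi> \<in> set (N # map (\<lambda>i p xs. xs ! i) [0..<k])" for \<Phi>
    using that N by (auto intro: total_rec_nth)
  ultimately have "total_rec k (\<lambda>p xs. (\<lambda>p ys. rec_nat (A p (tl ys)) (\<lambda>m v. B p m v (tl ys)) (hd ys)) p
      (map (\<lambda>\<Phi>. \<Phi> p xs) (N # map (\<lambda>i p xs. xs ! i) [0..<k])))"
    by (intro total_rec_compose) auto
  then show ?thesis
    by (rule total_rec_cong) (auto simp: comp_def map_nth)
qed

lemma total_rec_add:
  assumes "total_rec k a" "total_rec k b"
  shows "total_rec k (\<lambda>p xs. a p xs + b p xs)"
proof -
  have "total_rec k (\<lambda>p xs. rec_nat (a p xs) (\<lambda>m v. Suc v) (b p xs))"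
    using assms by (intro total_rec_prim total_rec_Suc total_rec_nth) auto
  moreover have "rec_nat x (\<lambda>m v. Suc v) y = x + y" for x y :: nat
    by (induction y) auto
  ultimately show ?thesis by simp
qed

lemma total_rec_mult:
  assumes "total_rec k a" "total_rec k b"
  shows "total_rec k (\<lambda>p xs. a p xs * b p xs)"
proof -
  have "total_rec 2 (\<lambda>p xs. rec_nat 0 (\<lambda>m v. v + xs ! 0) (xs ! 1))"
    by (intro total_rec_prim total_rec_add total_rec_const total_rec_nth total_rec_nth_tl_tl) auto
  moreover have "rec_nat 0 (\<lambda>m v. v + x) y = x * y" for x y :: nat
    by (induction y) auto
  ultimately have "total_rec 2 (\<lambda>p ys. ys ! 0 * ys ! 1)"
    by simp
  then show ?thesis
    by (rule total_rec_comp2[where F = "\<lambda>p x y. x * y", OF _ assms])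
qed

lemma total_rec_diff:
  assumes "total_rec k a" "total_rec k b"
  shows "total_rec k (\<lambda>p xs. a p xs - b p xs)"
proof -
  have pred: "total_rec k (\<lambda>p xs. c p xs - 1)" if "total_rec k c" for k c
  proof (rule total_rec_comp1[where F = "\<lambda>p x. x - 1", OF _ that])
    have "total_rec 1 (\<lambda>p xs. rec_nat 0 (\<lambda>m v. m) (xs ! 0))"
      by (intro total_rec_prim total_rec_const total_rec_nth) auto
    moreover have "rec_nat 0 (\<lambda>m v. m) y = y - 1" for y :: nat
      by (cases y) auto
    ultimately show "total_rec 1 (\<lambda>p xs. xs ! 0 - 1)" by simp
  qed
  have "total_rec k (\<lambda>p xs. rec_nat (a p xs) (\<lambda>m v. v - 1) (b p xs))"
    using assms by (intro total_rec_prim pred total_rec_nth) auto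
  moreover have "rec_nat x (\<lambda>m v. v - 1) y = x - y" for x y :: nat
    by (induction y) auto
  ultimately show ?thesis by simp
qed

lemma total_rec_power2:
  assumes "total_rec k a"
  shows "total_rec k (\<lambda>p xs. 2 ^ a p xs)"
proof -
  have "total_rec k (\<lambda>p xs. rec_nat 1 (\<lambda>m v. v * 2) (a p xs))"
    using assms by (intro total_rec_prim total_rec_mult total_rec_const total_rec_nth) auto
  moreover have "rec_nat 1 (\<lambda>m v. v * 2) y = (2::nat) ^ y" for y
    by (induction y) auto
  ultimately show ?thesis by simp
qed

lemma total_rec_sum:
  assumes "total_rec k N" "total_rec (Suc k) (\<lambda>p ys. B p (ys ! 0) (tl ys))"
  shows "total_rec k (\<lambda>p xs. \<Sum>i<N p xs. B p i xs)"
proof -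
  have "total_rec (Suc (Suc k)) \<Phi>"
    if "\<Phi> \<in> set ((\<lambda>p ys. ys ! 0) # map (\<lambda>i p ys. ys ! Suc (Suc i)) [0..<k])" for \<Phi>
    using that by (auto intro: total_rec_nth)
  then have "total_rec (Suc (Suc k)) (\<lambda>p ys. (\<lambda>p zs. B p (zs ! 0) (tl zs)) p
      (map (\<lambda>\<Phi>. \<Phi> p ys) ((\<lambda>p ys. ys ! 0) # map (\<lambda>i p ys. ys ! Suc (Suc i)) [0..<k])))"
    using assms(2) by (intro total_rec_compose) auto
  then have "total_rec (Suc (Suc k)) (\<lambda>p ys. B p (ys ! 0) (tl (tl ys)))"
  proof (rule total_rec_cong)
    fix p and ys :: "nat list" assume "length ys = Suc (Suc k)"
    then have "map (\<lambda>i. ys ! Suc (Suc i)) [0..<k] = tl (tl ys)"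
      by (auto intro!: nth_equalityI simp: nth_tl)
    then show "B p (map (\<lambda>\<Phi>. \<Phi> p ys) ((\<lambda>p ys. ys ! 0) # map (\<lambda>i p ys. ys ! Suc (Suc i)) [0..<k]) ! 0)
        (tl (map (\<lambda>\<Phi>. \<Phi> p ys) ((\<lambda>p ys. ys ! 0) # map (\<lambda>i p ys. ys ! Suc (Suc i)) [0..<k]))) =
        B p (ys ! 0) (tl (tl ys))"
      by (simp add: comp_def)
  qed
  then have "total_rec k (\<lambda>p xs. rec_nat 0 (\<lambda>m v. v + B p m xs) (N p xs))"
    using assms(1) by (intro total_rec_prim total_rec_add total_rec_const total_rec_nth) auto
  moreover have "rec_nat 0 (\<lambda>m v. v + f m) y = (\<Sum>i<y. f i)" for f :: "nat \<Rightarrow> nat" and y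
    by (induction y) auto
  ultimately show ?thesis by simp
qed

section \<open>Recursive predicates and arithmetic\<close>

abbreviation rec_pred :: "nat \<Rightarrow> (baire \<Rightarrow> nat list \<Rightarrow> bool) \<Rightarrow> bool" where
  "rec_pred k P \<equiv> total_rec k (\<lambda>p xs. of_bool (P p xs))"

lemma rec_pred_less:
  assumes "total_rec k a" "total_rec k b"
  shows "rec_pred k (\<lambda>p xs. a p xs < b p xs)"
  by (rule total_rec_cong[where \<Phi> = "\<lambda>p xs. 1 - (1 - (b p xs - a p xs))"])
    (intro total_rec_diff total_rec_const assms, auto)

lemma rec_pred_not:
  assumes "rec_pred k P" shows "rec_pred k (\<lambda>p xs. \<not> P p xs)"
  by (rule total_rec_cong[where \<Phi> = "\<lambda>p xs. 1 - of_bool (P p xs)"])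
    (intro total_rec_diff total_rec_const assms, auto)

lemma rec_pred_conj:
  assumes "rec_pred k P" "rec_pred k Q" shows "rec_pred k (\<lambda>p xs. P p xs \<and> Q p xs)"
  by (rule total_rec_cong[where \<Phi> = "\<lambda>p xs. of_bool (P p xs) * of_bool (Q p xs)"])
    (intro total_rec_mult assms, auto)

lemma rec_pred_disj:
  assumes "rec_pred k P" "rec_pred k Q" shows "rec_pred k (\<lambda>p xs. P p xs \<or> Q p xs)"
  by (rule total_rec_cong[where \<Phi> = "\<lambda>p xs. of_bool (\<not> (\<not> P p xs \<and> \<not> Q p xs))"])
    (intro rec_pred_conj rec_pred_not assms, auto)

lemma rec_pred_le:
  assumes "total_rec k a" "total_rec k b"
  shows "rec_pred k (\<lambda>p xs. a p xs \<le> b p xs)"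
  by (rule total_rec_cong[where \<Phi> = "\<lambda>p xs. of_bool (a p xs < Suc (b p xs))"])
    (intro rec_pred_less total_rec_Suc assms, auto)

lemma rec_pred_eq:
  assumes "total_rec k a" "total_rec k b"
  shows "rec_pred k (\<lambda>p xs. a p xs = b p xs)"
  by (rule total_rec_cong[where \<Phi> = "\<lambda>p xs. of_bool (a p xs \<le> b p xs \<and> b p xs \<le> a p xs)"])
    (intro rec_pred_conj rec_pred_le assms, auto)

lemma rec_pred_bex:
  assumes "total_rec k N" "rec_pred (Suc k) (\<lambda>p ys. P p (ys ! 0) (tl ys))"
  shows "rec_pred k (\<lambda>p xs. \<exists>i<N p xs. P p i xs)"
  by (rule total_rec_cong[where \<Phi> = "\<lambda>p xs. of_bool (0 < (\<Sum>i<N p xs. of_bool (P p i xs) :: nat))"])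
    (intro rec_pred_less total_rec_sum total_rec_const assms, auto simp: sum_nonneg_eq_0_iff)

lemma rec_pred_ball:
  assumes "total_rec k N" "rec_pred (Suc k) (\<lambda>p ys. P p (ys ! 0) (tl ys))"
  shows "rec_pred k (\<lambda>p xs. \<forall>i<N p xs. P p i xs)"
  by (rule total_rec_cong[where \<Phi> = "\<lambda>p xs. of_bool (\<not> (\<exists>i<N p xs. \<not> P p i xs))"])
    (intro rec_pred_not rec_pred_bex assms, auto)

lemma total_rec_if:
  assumes "rec_pred k P" "total_rec k a" "total_rec k b"
  shows "total_rec k (\<lambda>p xs. if P p xs then a p xs else b p xs)"
  by (rule total_rec_cong[where \<Phi> =
        "\<lambda>p xs. of_bool (P p xs) * a p xs + of_bool (\<not> P p xs) * b p xs"])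
    (intro total_rec_add total_rec_mult rec_pred_not assms, auto)

lemmas total_rec_basic =
  total_rec_nth total_rec_nth_tl total_rec_nth_tl_tl total_rec_const total_rec_Suc total_rec_oracle
  total_rec_add total_rec_mult total_rec_diff total_rec_power2 total_rec_sum total_rec_if
  rec_pred_less rec_pred_le rec_pred_eq rec_pred_not rec_pred_conj rec_pred_disj
  rec_pred_bex rec_pred_ball

text \<open>The quotient counts the positive multiples of the divisor up to the dividend.\<close>

lemma total_rec_div:
  assumes "total_rec k a" "total_rec k b"
  shows "total_rec k (\<lambda>p xs. a p xs div b p xs)"
proof -
  have "total_rec 2 (\<lambda>p xs. \<Sum>i<xs ! 0. of_bool (0 < xs ! 1 \<and> Suc i * xs ! 1 \<le> xs ! 0))"
    by (intro total_rec_basic) auto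
  moreover have "(\<Sum>i<x. of_bool (0 < y \<and> Suc i * y \<le> x)) = x div y" for x y :: nat
  proof (cases "y = 0")
    case False
    have "i < x \<and> Suc i * y \<le> x \<longleftrightarrow> i < x div y" for i
      using False div_le_dividend[of x y] less_eq_div_iff_mult_less_eq[of y "Suc i" x]
      by linarith
    then have "{..<x} \<inter> {i. Suc i * y \<le> x} = {..<x div y}"
      by blast
    then show ?thesis
      using False by (simp add: sum.If_cases of_bool_def del: mult_Suc)
  qed simp
  ultimately have "total_rec 2 (\<lambda>p ys. ys ! 0 div ys ! 1)"
    by simp
  then show ?thesis
    by (rule total_rec_comp2[where F = "\<lambda>p x y. x div y", OF _ assms])
qed

lemma total_rec_mod:
  assumes "total_rec k a" "total_rec k b"
  shows "total_rec k (\<lambda>p xs. a p xs mod b p xs)"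
  by (rule total_rec_cong[where \<Phi> = "\<lambda>p xs. a p xs - a p xs div b p xs * b p xs"])
    (intro total_rec_basic total_rec_div assms, simp add: minus_div_mult_eq_mod)

lemma total_rec_prod_encode:
  assumes "total_rec k a" "total_rec k b"
  shows "total_rec k (\<lambda>p xs. prod_encode (a p xs, b p xs))"
  unfolding prod_encode_def triangle_def prod.case
  by (intro total_rec_basic total_rec_div assms)

lemma total_rec_prod_decode:
  assumes "total_rec k a"
  shows "total_rec k (\<lambda>p xs. fst (prod_decode (a p xs)))"
    and "total_rec k (\<lambda>p xs. snd (prod_decode (a p xs)))"
proof -
  have eqs: "fst (prod_decode m) = (\<Sum>i<Suc m. i * of_bool (\<exists>j<Suc m. prod_encode (i, j) = m))"
    "snd (prod_decode m) = (\<Sum>i<Suc m. i * of_bool (\<exists>j<Suc m. prod_encode (j, i) = m))" for m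
  proof -
    obtain u v where uv: "prod_decode m = (u, v)" by fastforce
    then have m: "m = prod_encode (u, v)" by (metis prod_decode_inverse)
    have le: "u < Suc m" "v < Suc m"
      using le_prod_encode_1[of u v] le_prod_encode_2[of v u] by (auto simp: m)
    have iff: "(\<exists>j<Suc m. prod_encode (i, j) = m) \<longleftrightarrow> i = u"
      "(\<exists>j<Suc m. prod_encode (j, i) = m) \<longleftrightarrow> i = v" for i
      using le by (auto simp: m prod_encode_eq)
    show "fst (prod_decode m) = (\<Sum>i<Suc m. i * of_bool (\<exists>j<Suc m. prod_encode (i, j) = m))"
      "snd (prod_decode m) = (\<Sum>i<Suc m. i * of_bool (\<exists>j<Suc m. prod_encode (j, i) = m))"
      unfolding iff using le by (simp_all add: uv of_bool_def if_distrib cong: if_cong del: sum.lessThan_Suc)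
  qed
  have "total_rec 1 (\<lambda>p xs. fst (prod_decode (xs ! 0)))"
    "total_rec 1 (\<lambda>p xs. snd (prod_decode (xs ! 0)))"
    unfolding eqs by (intro total_rec_basic total_rec_prod_encode; simp)+
  then show "total_rec k (\<lambda>p xs. fst (prod_decode (a p xs)))"
    "total_rec k (\<lambda>p xs. snd (prod_decode (a p xs)))"
    by - (rule total_rec_comp1[where F = "\<lambda>p m. fst (prod_decode m)", OF _ assms]
        total_rec_comp1[where F = "\<lambda>p m. snd (prod_decode m)", OF _ assms], assumption)+
qed

lemmas total_rec_arith =
  total_rec_basic total_rec_div total_rec_mod total_rec_prod_encode total_rec_prod_decode

section \<open>Bounded evaluation of programs on partial oracles\<close>

text \<open>
  The semantics of programs with two kinds of finiteness built in: the oracle \<open>o'\<close> may be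
  undefined at some places, and the search in a minimisation stops at \<open>s\<close>.  A partial oracle
  is used rather than a finite string because the output of one bounded evaluation is then
  itself a legitimate oracle for another one.
\<close>

fun ev :: "recf \<Rightarrow> (nat \<rightharpoonup> nat) \<Rightarrow> nat \<Rightarrow> nat list \<Rightarrow> nat option" where
  "ev RZero o' s xs = Some 0"
| "ev RSucc o' s xs = (case xs of [] \<Rightarrow> None | x # _ \<Rightarrow> Some (Suc x))"
| "ev (RProj i) o' s xs = (if i < length xs then Some (xs ! i) else None)"
| "ev ROracle o' s xs = (case xs of [] \<Rightarrow> None | x # _ \<Rightarrow> o' x)"
| "ev (RComp g fs) o' s xs =
     (let ys = map (\<lambda>f. ev f o' s xs) fs
      in if None \<in> set ys then None else ev g o' s (map the ys))"
| "ev (RPrim f g) o' s xs =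
     (case xs of
        [] \<Rightarrow> None
      | n # zs \<Rightarrow>
          rec_nat (ev f o' s zs) (\<lambda>m r. Option.bind r (\<lambda>v. ev g o' s (m # v # zs))) n)"
| "ev (RMin f) o' s xs =
     (let Q = (\<lambda>y. ev f o' s (y # xs) = Some 0 \<and> (\<forall>z<y. \<exists>w. ev f o' s (z # xs) = Some (Suc w)))
      in if \<exists>y<s. Q y then Some (LEAST y. Q y) else None)"

text \<open>
  The two cases of minimisation in a relational form without \<open>LEAST\<close>, in which they differ only
  in the bound on the search.
\<close>

lemma run_RMin_eq_Some:
  "run (RMin f) p xs = Some y \<longleftrightarrow>
     run f p (y # xs) = Some 0 \<and> (\<forall>z<y. \<exists>w. run f p (z # xs) = Some (Suc w))"
proof -
  let ?P = "\<lambda>y. run f p (y # xs) = Some 0"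
  have "(\<exists>w. run f p (z # xs) = Some (Suc w)) \<longleftrightarrow> run f p (z # xs) \<noteq> None \<and> \<not> ?P z" for z
    by (cases "run f p (z # xs)") (auto simp: gr0_conv_Suc)
  then have r: "?P y \<and> (\<forall>z<y. \<exists>w. run f p (z # xs) = Some (Suc w)) \<longleftrightarrow>
      ?P y \<and> (\<forall>z<y. run f p (z # xs) \<noteq> None) \<and> (\<forall>z<y. \<not> ?P z)"
    by blast
  show ?thesis
  proof
    assume L: "run (RMin f) p xs = Some y"
    then obtain y' where y': "?P y'" "\<forall>z<y'. run f p (z # xs) \<noteq> None" and y: "y = (LEAST y. ?P y)"
      by (auto split: if_splits)
    from y' have "?P y" "y \<le> y'" "\<forall>z<y. \<not> ?P z"
      unfolding y by (auto intro: LeastI Least_le dest: not_less_Least)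
    then show "?P y \<and> (\<forall>z<y. \<exists>w. run f p (z # xs) = Some (Suc w))"
      unfolding r using y' by auto
  next
    assume "?P y \<and> (\<forall>z<y. \<exists>w. run f p (z # xs) = Some (Suc w))"
    then have R: "?P y" "\<forall>z<y. run f p (z # xs) \<noteq> None" "\<forall>z<y. \<not> ?P z"
      unfolding r by auto
    have "(LEAST y. ?P y) = y"
      using R by (intro Least_equality) (auto simp: not_less[symmetric])
    then show "run (RMin f) p xs = Some y"
      using R by auto
  qed
qed

lemma ev_RMin_eq_Some:
  "ev (RMin f) o' s xs = Some y \<longleftrightarrow> y < s \<and>
     ev f o' s (y # xs) = Some 0 \<and> (\<forall>z<y. \<exists>w. ev f o' s (z # xs) = Some (Suc w))"
proof -
  define Q where "Q = (\<lambda>y. ev f o' s (y # xs) = Some 0 \<and> (\<forall>z<y. \<exists>w. ev f o' s (z # xs) = Some (Suc w)))"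
  have uniq: "y = y'" if "Q y" "Q y'" for y y'
    using that unfolding Q_def by (metis linorder_neqE_nat nat.distinct(1) option.inject)
  have L: "(LEAST y. Q y) = y" if "Q y" for y
    using that uniq by (metis LeastI)
  have "ev (RMin f) o' s xs = (if \<exists>y<s. Q y then Some (LEAST y. Q y) else None)"
    unfolding ev.simps Let_def Q_def by (rule refl)
  also have "\<dots> = Some y \<longleftrightarrow> y < s \<and> Q y"
    using L by auto
  finally show ?thesis
    by (simp add: Q_def)
qed

text \<open>
  Every answer of a partial oracle below \<open>p\<close> and every minimum found within the bound is the true
  one, so bounded evaluation can fail but never err.
\<close>

lemma ev_sound:
  assumes "o' \<subseteq>\<^sub>m Some \<circ> p" "ev e o' s xs = Some v"
  shows "run e p xs = Some v"
  using assms(2)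
proof (induction e arbitrary: xs v)
  case ROracle
  then show ?case
    using assms(1) by (auto simp: map_le_def dom_def split: list.splits)
next
  case (RComp g fs)
  let ?ys = "map (\<lambda>f. ev f o' s xs) fs"
  have N: "None \<notin> set ?ys" and g: "ev g o' s (map the ?ys) = Some v"
    using RComp.prems by (auto simp: Let_def split: if_splits)
  have "map (\<lambda>f. run f p xs) fs = ?ys"
  proof (rule map_cong[OF refl])
    fix f assume "f \<in> set fs"
    with N obtain w where "ev f o' s xs = Some w" by force
    with RComp.IH(2)[OF \<open>f \<in> set fs\<close>] show "run f p xs = ev f o' s xs" by simp
  qed
  then show ?case
    using N RComp.IH(1)[OF g] by (simp only: run.simps Let_def if_False)
next
  case (RPrim f g)
  then obtain n zs where xs: "xs = n # zs" by (cases xs) auto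
  have "rec_nat (ev f o' s zs) (\<lambda>m r. Option.bind r (\<lambda>v. ev g o' s (m # v # zs))) n = Some v \<Longrightarrow>
      rec_nat (run f p zs) (\<lambda>m r. Option.bind r (\<lambda>v. run g p (m # v # zs))) n = Some v" for v
  proof (induction n arbitrary: v)
    case (Suc n)
    then show ?case
      using RPrim.IH(2) by (auto simp: bind_eq_Some_conv)
  qed (use RPrim.IH in auto)
  then show ?case
    using RPrim.prems by (simp add: xs)
next
  case (RMin f)
  then show ?case
    unfolding run_RMin_eq_Some ev_RMin_eq_Some by blast
qed (auto split: if_splits list.splits)

text \<open>
  The filter of growing finite information about \<open>p\<close>: the oracle is a restriction of \<open>p\<close> that
  covers longer and longer initial segments, and the stage tends to infinity.  As a filter
  it lets finitely many convergent subcomputations be combined by the calculus of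
  \<^const>\<open>eventually\<close>, without bookkeeping of moduli.
\<close>

definition approximations :: "baire \<Rightarrow> ((nat \<rightharpoonup> nat) \<times> nat) filter" where
  "approximations p = (INF b. principal {(o', s). o' \<subseteq>\<^sub>m Some \<circ> p \<and> {..<b} \<subseteq> dom o' \<and> b \<le> s})"

lemma eventually_approximations:
  "eventually P (approximations p) \<longleftrightarrow>
     (\<exists>b. \<forall>o' s. o' \<subseteq>\<^sub>m Some \<circ> p \<longrightarrow> {..<b} \<subseteq> dom o' \<longrightarrow> b \<le> s \<longrightarrow> P (o', s))"
proof -
  define A where "A = (\<lambda>b. {(o', s). o' \<subseteq>\<^sub>m Some \<circ> p \<and> {..<b} \<subseteq> dom o' \<and> b \<le> s})"
  have "A (max a b) \<subseteq> A a \<inter> A b" for a b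
    unfolding A_def by (auto simp: subset_iff)
  then have base: "\<exists>x\<in>UNIV. principal (A x) \<le> inf (principal (A a)) (principal (A b))" for a b
    by (intro bexI[of _ "max a b"]) simp_all
  have "eventually P (approximations p) \<longleftrightarrow> (\<exists>b\<in>UNIV. eventually P (principal (A b)))"
  proof -
    have "approximations p = (INF b. principal (A b))"
      by (simp add: approximations_def A_def)
    then show ?thesis
      by (simp only: eventually_INF_base[OF UNIV_not_empty base])
  qed
  then show ?thesis
    by (simp add: eventually_principal A_def Ball_def imp_conjL)
qed

lemma eventually_approximations_stage:
  "\<forall>\<^sub>F (o', s) in approximations p. b \<le> s"
  by (auto simp: eventually_approximations)

lemma eventually_approximations_oracle:
  "\<forall>\<^sub>F (o', s) in approximations p. o' i = Some (p i)"
  unfolding eventually_approximations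
  by (intro exI[of _ "Suc i"]) (auto simp: map_le_def subset_iff)

text \<open>
  Pointwise convergence suffices here, since a member of the filter only sees an initial segment
  of the oracle.
\<close>

lemma filterlim_approximations:
  assumes "\<forall>\<^sub>F x in F. O' x \<subseteq>\<^sub>m Some \<circ> p"
    and "\<And>i. \<forall>\<^sub>F x in F. O' x i = Some (p i)"
    and "\<And>b. \<forall>\<^sub>F x in F. b \<le> S x"
  shows "filterlim (\<lambda>x. (O' x, S x)) (approximations p) F"
  unfolding filterlim_iff
proof safe
  fix P assume "eventually P (approximations p)"
  then obtain b where b: "\<And>o' s. o' \<subseteq>\<^sub>m Some \<circ> p \<Longrightarrow> {..<b} \<subseteq> dom o' \<Longrightarrow> b \<le> s \<Longrightarrow> P (o', s)"
    unfolding eventually_approximations by blast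
  have "\<forall>\<^sub>F x in F. \<forall>i\<in>{..<b}. O' x i = Some (p i)"
    using assms(2) by (intro eventually_ball_finite) auto
  with assms(1) assms(3)[of b] show "\<forall>\<^sub>F x in F. P (O' x, S x)"
    by eventually_elim (rule b; blast)
qed

text \<open>
  A halting computation consists of finitely many steps, so it is reproduced as soon as
  the partial oracle and the stage are large enough.
\<close>

lemma ev_converges:
  assumes "run e p xs = Some v"
  shows "\<forall>\<^sub>F (o', s) in approximations p. ev e o' s xs = Some v"
  using assms
proof (induction e arbitrary: xs v)
  case ROracle
  then obtain x ys where xs: "xs = x # ys" by (cases xs) auto
  show ?case
    using eventually_approximations_oracle[of x p] ROracle by (simp add: xs)
next
  case (RComp g fs)
  let ?ys = "map (\<lambda>f. run f p xs) fs"
  have N: "None \<notin> set ?ys" and g: "run g p (map the ?ys) = Some v"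
    using RComp.prems by (auto simp: Let_def split: if_splits)
  have "\<forall>\<^sub>F (o', s) in approximations p. ev f o' s xs = run f p xs" if f: "f \<in> set fs" for f
  proof -
    obtain w where "run f p xs = Some w" using N f by force
    with RComp.IH(2)[OF f this] show ?thesis by simp
  qed
  then have "\<forall>\<^sub>F z in approximations p. \<forall>f\<in>set fs. ev f (fst z) (snd z) xs = run f p xs"
    by (intro eventually_ball_finite) (auto simp: case_prod_unfold)
  moreover have "\<forall>\<^sub>F z in approximations p. ev g (fst z) (snd z) (map the ?ys) = Some v"
    using RComp.IH(1)[OF g] by (simp add: case_prod_unfold)
  ultimately show ?case
    unfolding case_prod_unfold
  proof eventually_elim
    case (elim z)
    then have "map (\<lambda>f. ev f (fst z) (snd z) xs) fs = ?ys" by simp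
    then show ?case
      using N elim(2) by (simp only: ev.simps Let_def if_False)
  qed
next
  case (RPrim f g)
  then obtain n zs where xs: "xs = n # zs" by (cases xs) auto
  have "rec_nat (run f p zs) (\<lambda>m r. Option.bind r (\<lambda>v. run g p (m # v # zs))) n = Some v \<Longrightarrow>
      \<forall>\<^sub>F (o', s) in approximations p.
        rec_nat (ev f o' s zs) (\<lambda>m r. Option.bind r (\<lambda>v. ev g o' s (m # v # zs))) n = Some v" for v
  proof (induction n arbitrary: v)
    case (Suc n)
    then obtain w where w: "rec_nat (run f p zs) (\<lambda>m r. Option.bind r (\<lambda>v. run g p (m # v # zs))) n = Some w"
      and g: "run g p (n # w # zs) = Some v"
      by (auto simp: bind_eq_Some_conv)
    from Suc.IH[OF w] RPrim.IH(2)[OF g] show ?case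
      by eventually_elim auto
  qed (use RPrim.IH in auto)
  then show ?case
    using RPrim.prems by (simp add: xs)
next
  case (RMin f)
  have y: "run f p (v # xs) = Some 0" and "\<forall>z<v. \<exists>w. run f p (z # xs) = Some (Suc w)"
    using RMin.prems unfolding run_RMin_eq_Some by auto
  then obtain w where w: "\<And>z. z < v \<Longrightarrow> run f p (z # xs) = Some (Suc (w z))" by metis
  have "\<forall>\<^sub>F x in approximations p. \<forall>z\<in>{..<v}. ev f (fst x) (snd x) (z # xs) = Some (Suc (w z))"
    using RMin.IH[OF w] by (intro eventually_ball_finite) (auto simp: case_prod_unfold)
  with RMin.IH[OF y] eventually_approximations_stage[of "Suc v" p] show ?case
    unfolding case_prod_unfold ev_RMin_eq_Some by eventually_elim auto
qed (auto split: if_splits list.splits simp: case_prod_unfold)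

section \<open>Bounded evaluation is recursive\<close>

definition code :: "nat option \<Rightarrow> nat" where
  "code r = (case r of None \<Rightarrow> 0 | Some v \<Rightarrow> Suc v)"

lemma code_simps [simp]: "code None = 0" "code (Some v) = Suc v" "code r = 0 \<longleftrightarrow> r = None" "0 < code r \<longleftrightarrow> r \<noteq> None"
  "code r = Suc v \<longleftrightarrow> r = Some v"
  by (auto simp: code_def split: option.splits)

lemma the_eq_code: "r \<noteq> None \<Longrightarrow> the r = code r - 1"
  by auto

text \<open>
  Every construct becomes total under bounded evaluation, where undefinedness is
  represented by the code \<open>0\<close>.  The partial oracle and the stage may depend on a parameter,
  which is kept at the head of the argument list; since the program is fixed, the
  construction is an induction on programs.
\<close>

lemma total_rec_ev:
  assumes \<Theta>: "total_rec 2 (\<lambda>p ys. code (\<Theta> p (ys ! 0) (ys ! 1)))"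
    and S: "total_rec 1 (\<lambda>p ys. S (ys ! 0))"
  shows "total_rec (Suc k) (\<lambda>p ys. code (ev e (\<Theta> p (ys ! 0)) (S (ys ! 0)) (tl ys)))"
proof (induction e arbitrary: k)
  case RZero
  show ?case by (simp add: total_rec_const)
next
  case RSucc
  show ?case
  proof (cases k)
    case 0
    show ?thesis
      by (rule total_rec_cong[OF total_rec_const[of _ 0]]) (auto simp: 0 length_Suc_conv)
  next
    case (Suc k')
    then have "total_rec (Suc k) (\<lambda>p ys. Suc (Suc (ys ! 1)))"
      by (intro total_rec_basic) auto
    then show ?thesis
      by (rule total_rec_cong) (auto simp: Suc length_Suc_conv)
  qed
next
  case (RProj i)
  show ?case
  proof (cases "i < k")
    case False
    then show ?thesis
      by (intro total_rec_cong[OF total_rec_const[of _ 0]]) auto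
  next
    case True
    then have "total_rec (Suc k) (\<lambda>p ys. Suc (tl ys ! i))"
      by (intro total_rec_basic) auto
    then show ?thesis
      by (rule total_rec_cong) (auto simp: True)
  qed
next
  case ROracle
  show ?case
  proof (cases k)
    case 0
    show ?thesis
      by (rule total_rec_cong[OF total_rec_const[of _ 0]]) (auto simp: 0 length_Suc_conv)
  next
    case (Suc k')
    then have "total_rec (Suc k) (\<lambda>p ys. code (\<Theta> p (ys ! 0) (ys ! 1)))"
      by (intro total_rec_comp2[OF \<Theta>] total_rec_nth) auto
    then show ?thesis
      by (rule total_rec_cong) (auto simp: Suc length_Suc_conv)
  qed
next
  case (RComp g fs)
  define cs where "cs = map (\<lambda>f p ys. code (ev f (\<Theta> p (ys ! 0)) (S (ys ! 0)) (tl ys))) fs"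
  have cs: "total_rec (Suc k) \<Phi>" if "\<Phi> \<in> set cs" for \<Phi>
    using that RComp.IH(2) unfolding cs_def by auto
  have length_cs: "length cs = length fs"
    by (simp add: cs_def)
  have "total_rec (Suc k) (\<lambda>p ys. (\<lambda>p zs. code (ev g (\<Theta> p (zs ! 0)) (S (zs ! 0)) (tl zs))) p
      (map (\<lambda>\<Phi>. \<Phi> p ys) ((\<lambda>p ys. ys ! 0) # map (\<lambda>\<Phi> p ys. \<Phi> p ys - 1) cs)))"
    using RComp.IH(1)[of "length fs"]
    by (intro total_rec_compose) (auto simp: length_cs intro!: total_rec_nth total_rec_diff[OF cs total_rec_const, simplified])
  moreover have "rec_pred (Suc k) (\<lambda>p ys. \<forall>\<Phi>\<in>set fs'. 0 < \<Phi> p ys)" if "set fs' \<subseteq> set cs" for fs'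
    using that
  proof (induction fs')
    case (Cons \<Phi> fs')
    then show ?case
      using rec_pred_conj[OF rec_pred_less[OF total_rec_const cs, of \<Phi> 0], of "\<lambda>p ys. \<forall>\<Phi>\<in>set fs'. 0 < \<Phi> p ys"]
      by simp
  qed (use total_rec_const[of _ 1] in simp)
  ultimately have "total_rec (Suc k) (\<lambda>p ys. if \<forall>\<Phi>\<in>set cs. 0 < \<Phi> p ys
      then code (ev g (\<Theta> p (ys ! 0)) (S (ys ! 0)) (map (\<lambda>\<Phi>. \<Phi> p ys - 1) cs)) else 0)"
    by (intro total_rec_if total_rec_const) (auto simp: comp_def)
  then show ?case
  proof (rule total_rec_cong)
    fix p and ys :: "nat list"
    let ?rs = "map (\<lambda>f. ev f (\<Theta> p (ys ! 0)) (S (ys ! 0)) (tl ys)) fs"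
    have "(\<forall>\<Phi>\<in>set cs. 0 < \<Phi> p ys) \<longleftrightarrow> None \<notin> set ?rs"
      unfolding cs_def by (simp del: not_None_eq add: image_iff) metis
    moreover have "map (\<lambda>\<Phi>. \<Phi> p ys - 1) cs = map the ?rs" if "None \<notin> set ?rs"
      using that by (auto simp: cs_def the_eq_code image_iff)
    ultimately show "(if \<forall>\<Phi>\<in>set cs. 0 < \<Phi> p ys
      then code (ev g (\<Theta> p (ys ! 0)) (S (ys ! 0)) (map (\<lambda>\<Phi>. \<Phi> p ys - 1) cs)) else 0) =
      code (ev (RComp g fs) (\<Theta> p (ys ! 0)) (S (ys ! 0)) (tl ys))"
      unfolding ev.simps Let_def by (cases "None \<in> set ?rs") (simp_all only: not_not not_True_eq_False not_False_eq_True if_True if_False code_simps)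
  qed
next
  case (RPrim f g)
  show ?case
  proof (cases k)
    case 0
    show ?thesis
      by (rule total_rec_cong[OF total_rec_const[of _ 0]]) (auto simp: 0 length_Suc_conv)
  next
    case (Suc j)
    let ?E = "\<lambda>e p c xs. code (ev e (\<Theta> p c) (S c) xs)"
    have f: "total_rec (Suc k) (\<lambda>p ys. ?E f p (ys ! 0) (tl (tl ys)))"
    proof -
      have "total_rec (Suc k) (\<lambda>p ys. (\<lambda>p zs. ?E f p (zs ! 0) (tl zs)) p
          (map (\<lambda>\<Phi>. \<Phi> p ys) ((\<lambda>p ys. ys ! 0) # map (\<lambda>i p ys. ys ! Suc (Suc i)) [0..<j])))"
        using RPrim.IH(1)[of j] by (intro total_rec_compose) (auto intro!: total_rec_nth simp: Suc)
      then show ?thesis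
      proof (rule total_rec_cong)
        fix p and ys :: "nat list" assume "length ys = Suc k"
        then have "map (\<lambda>i. ys ! Suc (Suc i)) [0..<j] = tl (tl ys)"
          by (auto intro!: nth_equalityI simp: nth_tl Suc)
        then show "?E f p (map (\<lambda>\<Phi>. \<Phi> p ys) ((\<lambda>p ys. ys ! 0) # map (\<lambda>i p ys. ys ! Suc (Suc i)) [0..<j]) ! 0)
          (tl (map (\<lambda>\<Phi>. \<Phi> p ys) ((\<lambda>p ys. ys ! 0) # map (\<lambda>i p ys. ys ! Suc (Suc i)) [0..<j]))) =
          ?E f p (ys ! 0) (tl (tl ys))"
          by (simp add: comp_def)
      qed
    qed
    have g: "total_rec (Suc (Suc (Suc k)))
      (\<lambda>p ys. ?E g p (tl (tl ys) ! 0) (ys ! 0 # (ys ! 1 - 1) # tl (tl (tl (tl ys)))))"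
    proof -
      define \<Phi>s :: "(baire \<Rightarrow> nat list \<Rightarrow> nat) list" where
        "\<Phi>s = (\<lambda>p ys. ys ! 2) # (\<lambda>p ys. ys ! 0) # (\<lambda>p ys. ys ! 1 - 1) #
          map (\<lambda>i p ys. ys ! Suc (Suc (Suc (Suc i)))) [0..<j]"
      have "total_rec (Suc (Suc (Suc k))) (\<lambda>p ys. (\<lambda>p zs. ?E g p (zs ! 0) (tl zs)) p
          (map (\<lambda>\<Phi>. \<Phi> p ys) \<Phi>s))"
        using RPrim.IH(2)[of "Suc (Suc j)"]
        by (intro total_rec_compose) (auto intro!: total_rec_basic simp: Suc \<Phi>s_def)
      then show ?thesis
      proof (rule total_rec_cong)
        fix p and ys :: "nat list" assume l: "length ys = Suc (Suc (Suc k))"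
        then have "map (\<lambda>i. ys ! Suc (Suc (Suc (Suc i)))) [0..<j] = tl (tl (tl (tl ys)))"
          by (auto intro!: nth_equalityI simp: nth_tl Suc)
        moreover have "ys ! 2 = tl (tl ys) ! 0"
          using l by (simp add: nth_tl numeral_2_eq_2)
        ultimately show "?E g p (map (\<lambda>\<Phi>. \<Phi> p ys) \<Phi>s ! 0) (tl (map (\<lambda>\<Phi>. \<Phi> p ys) \<Phi>s)) =
            ?E g p (tl (tl ys) ! 0) (ys ! 0 # (ys ! 1 - 1) # tl (tl (tl (tl ys))))"
          by (simp add: comp_def \<Phi>s_def)
      qed
    qed
    have "total_rec (Suc k) (\<lambda>p ys. rec_nat (?E f p (ys ! 0) (tl (tl ys)))
        (\<lambda>m v. if v = 0 then 0 else ?E g p (ys ! 0) (m # (v - 1) # tl (tl ys))) (ys ! 1))"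
      using g Suc by (intro total_rec_prim f total_rec_basic) auto
    then show ?thesis
    proof (rule total_rec_cong)
      fix p and ys :: "nat list" assume "length ys = Suc k"
      then obtain c n zs where ys: "ys = c # n # zs"
        by (auto simp: Suc length_Suc_conv)
      have "rec_nat (?E f p c zs) (\<lambda>m v. if v = 0 then 0 else ?E g p c (m # (v - 1) # zs)) n =
        code (rec_nat (ev f (\<Theta> p c) (S c) zs)
          (\<lambda>m r. Option.bind r (\<lambda>v. ev g (\<Theta> p c) (S c) (m # v # zs))) n)"
      proof (induction n)
        case (Suc n)
        then show ?case
          by (cases "rec_nat (ev f (\<Theta> p c) (S c) zs)
            (\<lambda>m r. Option.bind r (\<lambda>v. ev g (\<Theta> p c) (S c) (m # v # zs))) n") auto
      qed simp
      then show "rec_nat (?E f p (ys ! 0) (tl (tl ys)))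
        (\<lambda>m v. if v = 0 then 0 else ?E g p (ys ! 0) (m # (v - 1) # tl (tl ys))) (ys ! 1) =
        ?E (RPrim f g) p (ys ! 0) (tl ys)"
        by (simp add: ys cong: if_cong)
    qed
  qed
next
  case (RMin f)
  let ?E = "\<lambda>p y ys. code (ev f (\<Theta> p (ys ! 0)) (S (ys ! 0)) (y # tl ys))"
  (* Under one and two further bound variables the arguments have to be rearranged. *)
  have f: "total_rec (Suc (Suc k)) (\<lambda>p zs. ?E p (zs ! 0) (tl zs))"
  proof -
    define \<Phi>s :: "(baire \<Rightarrow> nat list \<Rightarrow> nat) list" where
      "\<Phi>s = (\<lambda>p ys. ys ! 1) # (\<lambda>p ys. ys ! 0) # map (\<lambda>i p ys. ys ! Suc (Suc i)) [0..<k]"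
    have "total_rec (Suc (Suc k)) (\<lambda>p ys.
        (\<lambda>p zs. code (ev f (\<Theta> p (zs ! 0)) (S (zs ! 0)) (tl zs))) p (map (\<lambda>\<Phi>. \<Phi> p ys) \<Phi>s))"
      using RMin.IH[of "Suc k"] unfolding \<Phi>s_def
      by (intro total_rec_compose) (auto intro!: total_rec_basic)
    then show ?thesis
    proof (rule total_rec_cong)
      fix p and ys :: "nat list" assume l: "length ys = Suc (Suc k)"
      then have "map (\<lambda>i. ys ! Suc (Suc i)) [0..<k] = tl (tl ys)"
        by (auto intro!: nth_equalityI simp: nth_tl)
      moreover have "ys ! 1 = tl ys ! 0"
        using l by (simp add: nth_tl)
      ultimately show "code (ev f (\<Theta> p (map (\<lambda>\<Phi>. \<Phi> p ys) \<Phi>s ! 0)) (S (map (\<lambda>\<Phi>. \<Phi> p ys) \<Phi>s ! 0))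
          (tl (map (\<lambda>\<Phi>. \<Phi> p ys) \<Phi>s))) = ?E p (ys ! 0) (tl ys)"
        by (simp add: comp_def \<Phi>s_def)
    qed
  qed
  have f': "total_rec (Suc (Suc (Suc k))) (\<lambda>p zs. ?E p (zs ! 0) (tl (tl zs)))"
  proof -
    define \<Phi>s :: "(baire \<Rightarrow> nat list \<Rightarrow> nat) list" where
      "\<Phi>s = (\<lambda>p ys. ys ! 0) # map (\<lambda>i p ys. ys ! Suc (Suc i)) [0..<Suc k]"
    have "total_rec (Suc (Suc (Suc k))) (\<lambda>p ys. (\<lambda>p zs. ?E p (zs ! 0) (tl zs)) p (map (\<lambda>\<Phi>. \<Phi> p ys) \<Phi>s))"
      using f unfolding \<Phi>s_def
      by (intro total_rec_compose) (auto intro!: total_rec_basic simp del: upt_Suc)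
    then show ?thesis
    proof (rule total_rec_cong)
      fix p and ys :: "nat list" assume l: "length ys = Suc (Suc (Suc k))"
      then have "map (\<lambda>i. ys ! Suc (Suc i)) [0..<Suc k] = tl (tl ys)"
        by (auto intro!: nth_equalityI simp: nth_tl simp del: upt_Suc)
      then show "?E p (map (\<lambda>\<Phi>. \<Phi> p ys) \<Phi>s ! 0) (tl (map (\<lambda>\<Phi>. \<Phi> p ys) \<Phi>s)) = ?E p (ys ! 0) (tl (tl ys))"
        by (simp add: comp_def \<Phi>s_def del: upt_Suc)
    qed
  qed
  (* At most one summand is nonzero, and it is the code of the result of the search. *)
  have "total_rec (Suc k) (\<lambda>p ys. \<Sum>y<S (ys ! 0).
      if ?E p y ys = 1 \<and> (\<forall>z<y. 1 < ?E p z ys) then Suc y else 0)"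
    by (intro total_rec_basic f f' total_rec_comp1[OF S]) auto
  then show ?case
  proof (rule total_rec_cong)
    fix p and ys :: "nat list"
    let ?r = "ev (RMin f) (\<Theta> p (ys ! 0)) (S (ys ! 0)) (tl ys)"
    have r: "?r = Some y \<longleftrightarrow> y < S (ys ! 0) \<and> ?E p y ys = 1 \<and> (\<forall>z<y. 1 < ?E p z ys)" for y
    proof -
      have "(\<exists>w. r = Some (Suc w)) \<longleftrightarrow> 1 < code r" for r
        by (cases r) (auto simp: gr0_conv_Suc)
      then show ?thesis
        unfolding ev_RMin_eq_Some by simp
    qed
    have "(\<Sum>y<S (ys ! 0). if ?E p y ys = 1 \<and> (\<forall>z<y. 1 < ?E p z ys) then Suc y else 0) =
        (\<Sum>y<S (ys ! 0). if ?r = Some y then Suc y else 0)"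
      by (rule sum.cong) (simp_all only: r lessThan_iff simp_thms)
    also have "\<dots> = code ?r"
    proof -
      have "(\<Sum>y<n. if q = Some y then Suc y else 0) = code q" if "\<And>y. q = Some y \<Longrightarrow> y < n" for q n
        using that by (cases q) auto
      then show ?thesis
        using r by blast
    qed
    finally show "(\<Sum>y<S (ys ! 0). if ?E p y ys = 1 \<and> (\<forall>z<y. 1 < ?E p z ys) then Suc y else 0) = code ?r" .
  qed
qed

section \<open>Computable and continuous functions\<close>

text \<open>Substitution for the oracle turns composition of functions into an operation on programs.\<close>

fun osubst :: "recf \<Rightarrow> recf \<Rightarrow> recf" where
  "osubst d RZero = RZero"
| "osubst d RSucc = RSucc"
| "osubst d (RProj i) = RProj i"
| "osubst d ROracle = RComp d [RProj 0]"
| "osubst d (RComp g fs) = RComp (osubst d g) (map (osubst d) fs)"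
| "osubst d (RPrim f g) = RPrim (osubst d f) (osubst d g)"
| "osubst d (RMin f) = RMin (osubst d f)"

lemma run_osubst:
  assumes "\<And>n. run d p [n] = Some (q n)"
  shows "run (osubst d e) p xs = run e q xs"
proof (induction e arbitrary: xs)
  case (RComp g fs)
  have ys: "map (\<lambda>f. run f p xs) (map (osubst d) fs) = map (\<lambda>f. run f q xs) fs"
    using RComp.IH(2) by simp
  show ?case
    unfolding osubst.simps run.simps Let_def ys RComp.IH(1) by (rule refl)
qed (auto simp: assms split: list.split)

lemma total_rec_unary_program:
  assumes "total_rec 1 (\<lambda>p ys. F p (ys ! 0))"
  obtains e where "\<And>p n. run e p [n] = Some (F p n)"
proof -
  obtain e where e: "\<And>p xs. length xs = 1 \<Longrightarrow> run e p xs = Some (F p (xs ! 0))"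
    using assms unfolding total_rec_def by blast
  show thesis
    by (rule that[of e]) (simp add: e)
qed

lemma computable_total_rec:
  assumes "total_rec 1 (\<lambda>p ys. F p (ys ! 0))"
  shows "computable (\<lambda>p. Some (F p))"
  using total_rec_unary_program[OF assms] unfolding computable_def by (metis option.inject)

lemma computable_bind:
  assumes "computable F" "computable G"
  shows "computable (\<lambda>p. Option.bind (F p) G)"
proof -
  obtain d where d: "\<And>p q n. F p = Some q \<Longrightarrow> run d p [n] = Some (q n)"
    using assms(1) unfolding computable_def by blast
  obtain e where e: "\<And>p q n. G p = Some q \<Longrightarrow> run e p [n] = Some (q n)"
    using assms(2) unfolding computable_def by blast
  have "run (osubst d e) p [n] = Some (q n)" if "Option.bind (F p) G = Some q" for p q n
    using that run_osubst[of d p, OF d] e by (auto simp: bind_eq_Some_conv)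
  then show ?thesis
    unfolding computable_def by blast
qed

definition pair_partial :: "(baire \<rightharpoonup> baire) \<Rightarrow> (baire \<rightharpoonup> baire) \<Rightarrow> baire \<rightharpoonup> baire" where
  "pair_partial F G p = Option.bind (F p) (\<lambda>a. Option.bind (G p) (\<lambda>b. Some (baire_pair a b)))"

lemma pair_partial_eq_Some:
  "pair_partial F G p = Some q \<longleftrightarrow> (\<exists>a b. F p = Some a \<and> G p = Some b \<and> q = baire_pair a b)"
  by (auto simp: pair_partial_def bind_eq_Some_conv)

text \<open>
  Both components are evaluated at half of the argument and one value is selected afterwards.
  This is harmless because the pair is defined only where both components are total.
\<close>

lemma computable_pair_partial:
  assumes "computable F" "computable G"
  shows "computable (pair_partial F G)"
proof -
  obtain d where d: "\<And>p q n. F p = Some q \<Longrightarrow> run d p [n] = Some (q n)"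
    using assms(1) unfolding computable_def by blast
  obtain e where e: "\<And>p q n. G p = Some q \<Longrightarrow> run e p [n] = Some (q n)"
    using assms(2) unfolding computable_def by blast
  have "total_rec 1 (\<lambda>p ys. ys ! 0 div 2)"
    by (intro total_rec_arith) auto
  then obtain h where h: "\<And>p n. run h p [n] = Some (n div 2)"
    by (rule total_rec_unary_program[where F = "\<lambda>p n. n div 2"]) blast
  have "total_rec 3 (\<lambda>p ys. if ys ! 2 mod 2 = 0 then ys ! 0 else ys ! 1)"
    by (intro total_rec_arith) auto
  then obtain c where "\<And>p xs. length xs = 3 \<Longrightarrow>
      run c p xs = Some (if xs ! 2 mod 2 = 0 then xs ! 0 else xs ! 1)"
    unfolding total_rec_def by blast
  then have c: "run c p [a, b, n] = Some (if n mod 2 = 0 then a else b)" for p a b n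
    by simp
  have "run (RComp c [RComp d [h], RComp e [h], RProj 0]) p [n] = Some (q n)"
    if "pair_partial F G p = Some q" for p q n
    using that by (auto simp: pair_partial_eq_Some c d e h baire_pair_def even_iff_mod_2_eq_zero)
  then show ?thesis
    unfolding computable_def by blast
qed

text \<open>
  In the product topology the sequences with a common initial segment form a base of
  neighbourhoods, so continuity means that every output value depends on finitely many inputs.
\<close>

lemma continuous_partial_iff:
  "continuous_partial F \<longleftrightarrow>
     (\<forall>p q n. F p = Some q \<longrightarrow> (\<exists>b. \<forall>p' q'. F p' = Some q' \<longrightarrow> (\<forall>i<b. p' i = p i) \<longrightarrow> q' n = q n))"
proof safe
  fix p q n assume F: "continuous_partial F" "F p = Some q"
  have "continuous_on (dom F) (\<lambda>p. the (F p) n)"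
    using F(1) unfolding continuous_partial_def by (rule continuous_on_product_then_coordinatewise)
  with F(2) have "\<forall>\<^sub>F p' in at p within dom F. the (F p') n = q n"
    unfolding continuous_on_def tendsto_discrete by force
  then obtain T where T: "open T" "p \<in> T" "\<And>p'. p' \<in> T \<Longrightarrow> p' \<noteq> p \<Longrightarrow> p' \<in> dom F \<Longrightarrow> the (F p') n = q n"
    unfolding eventually_at_topological by blast
  obtain U where U: "p \<in> (\<Pi>\<^sub>E i\<in>UNIV. U i)" "finite {i. U i \<noteq> UNIV}" "(\<Pi>\<^sub>E i\<in>UNIV. U i) \<subseteq> T"
    using product_topology_open_contains_basis[OF T(1)[unfolded open_fun_def] T(2)]
    by (simp only: topspace_euclidean) blast
  obtain b where b: "\<And>i. U i \<noteq> UNIV \<Longrightarrow> i < b"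
    using finite_nat_bounded[OF U(2)] by auto
  have "q' n = q n" if "F p' = Some q'" "\<forall>i<b. p' i = p i" for p' q'
  proof (cases "p' = p")
    case False
    have "p' i \<in> U i" for i
      using that(2) b[of i] U(1) by (cases "U i = UNIV") auto
    then have "p' \<in> T"
      using U(3) by auto
    then show ?thesis
      using T(3)[of p'] False that(1) by auto
  qed (use that F(2) in auto)
  then show "\<exists>b. \<forall>p' q'. F p' = Some q' \<longrightarrow> (\<forall>i<b. p' i = p i) \<longrightarrow> q' n = q n"
    by blast
next
  assume L: "\<forall>p q n. F p = Some q \<longrightarrow> (\<exists>b. \<forall>p' q'. F p' = Some q' \<longrightarrow> (\<forall>i<b. p' i = p i) \<longrightarrow> q' n = q n)"
  show "continuous_partial F"
    unfolding continuous_partial_def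
  proof (rule continuous_on_coordinatewise_then_product)
    fix n
    show "continuous_on (dom F) (\<lambda>p. the (F p) n)"
      unfolding continuous_on_def tendsto_discrete
    proof
      fix p assume "p \<in> dom F"
      then obtain q where q: "F p = Some q" by blast
      with L obtain b where b: "\<And>p' q'. F p' = Some q' \<Longrightarrow> (\<forall>i<b. p' i = p i) \<Longrightarrow> q' n = q n"
        by blast
      have "\<forall>\<^sub>F p' in at p within dom F. p' i = p i" for i
      proof -
        have "continuous_on (dom F) (\<lambda>p. p i :: nat)"
          by (rule continuous_on_subset[OF continuous_on_product_coordinates]) simp
        with \<open>p \<in> dom F\<close> show ?thesis
          unfolding continuous_on_def tendsto_discrete by blast
      qed
      then have "\<forall>\<^sub>F p' in at p within dom F. \<forall>i\<in>{..<b}. p' i = p i"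
        by (intro eventually_ball_finite) auto
      moreover have "\<forall>\<^sub>F p' in at p within dom F. p' \<in> dom F"
        by (simp add: eventually_at_filter)
      ultimately show "\<forall>\<^sub>F p' in at p within dom F. the (F p') n = the (F p) n"
      proof eventually_elim
        case (elim p')
        then obtain q' where "F p' = Some q'" by blast
        with b[of p' q'] elim(1) q show ?case by simp
      qed
    qed
  qed
qed

lemma continuous_partial_bind:
  assumes F: "continuous_partial F" and G: "continuous_partial G"
  shows "continuous_partial (\<lambda>p. Option.bind (F p) G)"
  unfolding continuous_partial_iff
proof (intro allI impI)
  fix p r n assume "Option.bind (F p) G = Some r"
  then obtain q where q: "F p = Some q" "G q = Some r"
    by (auto simp: bind_eq_Some_conv)
  from q(2) G obtain b where b: "\<And>q' r'. G q' = Some r' \<Longrightarrow> \<forall>i<b. q' i = q i \<Longrightarrow> r' n = r n"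
    unfolding continuous_partial_iff by blast
  have "\<forall>i. \<exists>c. \<forall>p' q'. F p' = Some q' \<longrightarrow> (\<forall>j<c. p' j = p j) \<longrightarrow> q' i = q i"
    using q(1) F unfolding continuous_partial_iff by blast
  then obtain c where c: "\<And>i p' q'. F p' = Some q' \<Longrightarrow> \<forall>j<c i. p' j = p j \<Longrightarrow> q' i = q i"
    by metis
  have "r' n = r n" if r': "Option.bind (F p') G = Some r'" and eq: "\<forall>j<(\<Sum>i<b. c i). p' j = p j" for p' r'
  proof -
    obtain q' where q': "F p' = Some q'" "G q' = Some r'"
      using r' by (auto simp: bind_eq_Some_conv)
    have "q' i = q i" if "i < b" for i
    proof (rule c[OF q'(1)])
      have "c i \<le> (\<Sum>i<b. c i)"
        using that by (intro member_le_sum) auto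
      then show "\<forall>j<c i. p' j = p j"
        using eq by auto
    qed
    then show ?thesis
      using b[OF q'(2)] by blast
  qed
  then show "\<exists>b. \<forall>p' q'. Option.bind (F p') G = Some q' \<longrightarrow> (\<forall>i<b. p' i = p i) \<longrightarrow> q' n = r n"
    by blast
qed

lemma continuous_partial_pair_partial:
  assumes F: "continuous_partial F" and G: "continuous_partial G"
  shows "continuous_partial (pair_partial F G)"
  unfolding continuous_partial_iff
proof (intro allI impI)
  fix p r n assume "pair_partial F G p = Some r"
  then obtain u v where uv: "F p = Some u" "G p = Some v" "r = baire_pair u v"
    by (auto simp: pair_partial_eq_Some)
  obtain b where b: "\<And>p' u'. F p' = Some u' \<Longrightarrow> \<forall>i<b. p' i = p i \<Longrightarrow> u' (n div 2) = u (n div 2)"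
    using F uv(1) unfolding continuous_partial_iff by blast
  obtain c where c: "\<And>p' v'. G p' = Some v' \<Longrightarrow> \<forall>i<c. p' i = p i \<Longrightarrow> v' (n div 2) = v (n div 2)"
    using G uv(2) unfolding continuous_partial_iff by blast
  show "\<exists>b. \<forall>p' q'. pair_partial F G p' = Some q' \<longrightarrow> (\<forall>i<b. p' i = p i) \<longrightarrow> q' n = r n"
    by (rule exI[of _ "max b c"]) (use b c in \<open>auto simp: pair_partial_eq_Some baire_pair_def uv(3)\<close>)
qed

definition initial :: "baire \<Rightarrow> nat \<Rightarrow> nat \<rightharpoonup> nat" where
  "initial p s i = (if i < s then Some (p i) else None)"

lemma initial_map_le: "\<forall>i<s. q i = p i \<Longrightarrow> initial p s \<subseteq>\<^sub>m Some \<circ> q"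
  by (auto simp: initial_def map_le_def split: if_splits)

lemma filterlim_initial: "filterlim (\<lambda>s. (initial p s, s)) (approximations p) sequentially"
proof (rule filterlim_approximations)
  show "\<forall>\<^sub>F s in sequentially. initial p s i = Some (p i)" for i
    using eventually_gt_at_top[of i] by eventually_elim (simp add: initial_def)
qed (auto simp: initial_def map_le_def dom_def eventually_ge_at_top)

text \<open>A bounded evaluation that succeeds has read only a finite part of the oracle.\<close>

lemma computable_imp_continuous_partial:
  assumes "computable F" shows "continuous_partial F"
  unfolding continuous_partial_iff
proof (intro allI impI)
  fix p q n assume "F p = Some q"
  obtain e where e: "\<And>p q n. F p = Some q \<Longrightarrow> run e p [n] = Some (q n)"
    using assms unfolding computable_def by blast
  have "\<forall>\<^sub>F s in sequentially. ev e (initial p s) s [n] = Some (q n)"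
    using eventually_compose_filterlim[OF ev_converges[OF e[OF \<open>F p = Some q\<close>]] filterlim_initial] by simp
  then obtain s where s: "ev e (initial p s) s [n] = Some (q n)"
    by (auto simp: eventually_sequentially)
  have "q' n = q n" if "F p' = Some q'" "\<forall>i<s. p' i = p i" for p' q'
  proof -
    have "initial p s \<subseteq>\<^sub>m Some \<circ> p'"
      using that(2) by (rule initial_map_le)
    from ev_sound[OF this s] e[OF that(1), of n] show ?thesis by simp
  qed
  then show "\<exists>b. \<forall>p' q'. F p' = Some q' \<longrightarrow> (\<forall>i<b. p' i = p i) \<longrightarrow> q' n = q n"
    by blast
qed

section \<open>Approximation of partial functions by finite information\<close>

text \<open>
  An approximator receives a partial oracle and a stage and returns the part of the output that
  it already knows.  Its behaviour matters only for oracles that can be extended to a point of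
  the domain of the approximated function.
\<close>

type_synonym approximator = "(nat \<rightharpoonup> nat) \<Rightarrow> nat \<Rightarrow> nat \<rightharpoonup> nat"

definition approximates :: "approximator \<Rightarrow> (baire \<rightharpoonup> baire) \<Rightarrow> bool" where
  "approximates A F \<longleftrightarrow> (\<forall>p q. F p = Some q \<longrightarrow>
     (\<forall>o' s. o' \<subseteq>\<^sub>m Some \<circ> p \<longrightarrow> A o' s \<subseteq>\<^sub>m Some \<circ> q) \<and>
     (\<forall>n. \<forall>\<^sub>F (o', s) in approximations p. A o' s n = Some (q n)))"

lemma approximates_sound:
  "approximates A F \<Longrightarrow> F p = Some q \<Longrightarrow> o' \<subseteq>\<^sub>m Some \<circ> p \<Longrightarrow> A o' s \<subseteq>\<^sub>m Some \<circ> q"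
  unfolding approximates_def by blast

lemma approximates_converges:
  "approximates A F \<Longrightarrow> F p = Some q \<Longrightarrow> \<forall>\<^sub>F (o', s) in approximations p. A o' s n = Some (q n)"
  unfolding approximates_def by blast

definition program_approximator :: "recf \<Rightarrow> approximator" where
  "program_approximator e o' s n = ev e o' s [n]"

lemma computable_approximates:
  assumes "computable F"
  shows "\<exists>e. approximates (program_approximator e) F"
proof -
  obtain e where e: "\<And>p q n. F p = Some q \<Longrightarrow> run e p [n] = Some (q n)"
    using assms unfolding computable_def by blast
  have "program_approximator e o' s \<subseteq>\<^sub>m Some \<circ> q" if "F p = Some q" "o' \<subseteq>\<^sub>m Some \<circ> p" for p q o' s
    unfolding map_le_def program_approximator_def
    using ev_sound[OF that(2)] e[OF that(1)] by fastforce
  then show ?thesis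
    using ev_converges[OF e] unfolding approximates_def program_approximator_def by blast
qed

text \<open>
  The approximator announces a value exactly when the partial oracle forces it, that
  is, when all its extensions in the domain agree on it.  Continuity guarantees that this happens.
\<close>

lemma continuous_approximates:
  assumes "continuous_partial F"
  shows "\<exists>A. approximates A F"
proof -
  define A :: approximator where "A = (\<lambda>o' s n.
    if \<exists>v. \<forall>p q. F p = Some q \<longrightarrow> o' \<subseteq>\<^sub>m Some \<circ> p \<longrightarrow> q n = v
    then Some (SOME v. \<forall>p q. F p = Some q \<longrightarrow> o' \<subseteq>\<^sub>m Some \<circ> p \<longrightarrow> q n = v) else None)"
  have eq: "v = q n" if "A o' s n = Some v" "F p = Some q" "o' \<subseteq>\<^sub>m Some \<circ> p" for o' s n v p q
  proof -
    let ?P = "\<lambda>v. \<forall>p q. F p = Some q \<longrightarrow> o' \<subseteq>\<^sub>m Some \<circ> p \<longrightarrow> q n = v"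
    have "\<exists>v. ?P v" and v: "v = (SOME v. ?P v)"
      using that(1) unfolding A_def by (auto split: if_splits)
    from this(1) have "?P v" unfolding v by (rule someI_ex)
    then show ?thesis using that by blast
  qed
  have "\<forall>\<^sub>F (o', s) in approximations p. A o' s n = Some (q n)" if F: "F p = Some q" for p q n
  proof -
    obtain b where b: "\<And>p' q'. F p' = Some q' \<Longrightarrow> \<forall>i<b. p' i = p i \<Longrightarrow> q' n = q n"
      using assms F unfolding continuous_partial_iff by blast
    have "A o' s n = Some (q n)" if o': "o' \<subseteq>\<^sub>m Some \<circ> p" "{..<b} \<subseteq> dom o'" for o' s
    proof -
      have "q' n = q n" if "F p' = Some q'" "o' \<subseteq>\<^sub>m Some \<circ> p'" for p' q'
      proof (rule b[OF that(1)], intro allI impI)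
        fix i assume "i < b"
        then have "i \<in> dom o'" using o'(2) by blast
        then have "o' i = Some (p i)" "o' i = Some (p' i)"
          using o'(1) that(2) unfolding map_le_def by auto
        then show "p' i = p i" by simp
      qed
      then have "A o' s n \<noteq> None"
        unfolding A_def by auto
      then obtain v where "A o' s n = Some v" by blast
      with eq[OF this F o'(1)] show ?thesis by simp
    qed
    then show ?thesis
      unfolding eventually_approximations by blast
  qed
  moreover have "A o' s \<subseteq>\<^sub>m Some \<circ> q" if "F p = Some q" "o' \<subseteq>\<^sub>m Some \<circ> p" for p q o' s
    using eq[OF _ that] by (fastforce simp: map_le_def)
  ultimately have "approximates A F"
    unfolding approximates_def by blast
  then show ?thesis by blast
qed

section \<open>Solutions of the parallelization of LLPO as unrefuted sequences\<close>

definition at_most_one_nonzero :: "baire \<Rightarrow> bool" where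
  "at_most_one_nonzero p \<longleftrightarrow> (\<forall>i j. p i \<noteq> 0 \<and> p j \<noteq> 0 \<longrightarrow> i = j)"

lemma mem_LLPO_iff:
  "v \<in> LLPO p \<longleftrightarrow> at_most_one_nonzero p \<and> v < 2 \<and> (\<forall>n. v = n mod 2 \<longrightarrow> p n = 0)"
proof -
  have ev: "(\<forall>n. p (2 * n) = 0) \<longleftrightarrow> (\<forall>n. 0 = n mod 2 \<longrightarrow> p n = 0)"
    by (metis mod_mult_self1_is_0 mod_0_imp_dvd dvdE)
  have od: "(\<forall>n. p (2 * n + 1) = 0) \<longleftrightarrow> (\<forall>n. 1 = n mod 2 \<longrightarrow> p n = 0)"
    by (metis odd_two_times_div_two_succ odd_iff_mod_2_eq_one even_mult_iff even_plus_one_iff dvd_refl)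
  have "v \<in> LLPO p \<longleftrightarrow> at_most_one_nonzero p \<and>
      (v = 0 \<and> (\<forall>n. p (2 * n) = 0) \<or> v = 1 \<and> (\<forall>n. p (2 * n + 1) = 0))"
    unfolding LLPO_def at_most_one_nonzero_def[symmetric] by simp
  then show ?thesis
    unfolding ev od less_2_cases_iff by auto
qed

lemma LLPO_hat_nonempty_iff:
  "LLPO_hat r \<noteq> {} \<longleftrightarrow> (\<forall>k. at_most_one_nonzero (\<lambda>n. r (prod_encode (k, n))))"
proof
  assume R: "\<forall>k. at_most_one_nonzero (\<lambda>n. r (prod_encode (k, n)))"
  have "\<exists>v. v \<in> LLPO (\<lambda>n. r (prod_encode (k, n)))" for k
  proof (cases "\<forall>n. 0 = n mod 2 \<longrightarrow> r (prod_encode (k, n)) = 0")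
    case True
    then show ?thesis
      using R by (intro exI[of _ 0]) (simp add: mem_LLPO_iff)
  next
    case False
    then obtain n where n: "0 = n mod 2" "r (prod_encode (k, n)) \<noteq> 0"
      by blast
    have "r (prod_encode (k, m)) = 0" if "1 = m mod 2" for m
    proof -
      have "m \<noteq> n" using that n(1) by auto
      then show ?thesis
        using R n(2) unfolding at_most_one_nonzero_def by blast
    qed
    then show ?thesis
      using R by (intro exI[of _ 1]) (simp add: mem_LLPO_iff)
  qed
  then show "LLPO_hat r \<noteq> {}"
    unfolding LLPO_hat_def using choice[of "\<lambda>k v. v \<in> LLPO (\<lambda>n. r (prod_encode (k, n)))"] by blast
qed (auto simp: LLPO_hat_def mem_LLPO_iff)

text \<open>
  A nonzero entry of the instance refutes the answer of its own parity in its own component.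
  The instance is a partial function, because it will be known only in part.
\<close>

definition refutes :: "(nat \<rightharpoonup> nat) \<Rightarrow> baire \<Rightarrow> nat \<Rightarrow> bool" where
  "refutes r q m \<longleftrightarrow> (\<exists>w. r m = Some (Suc w)) \<and>
     q (fst (prod_decode m)) = snd (prod_decode m) mod 2"

lemma mem_LLPO_hat_iff:
  "q \<in> LLPO_hat r \<longleftrightarrow> LLPO_hat r \<noteq> {} \<and> (\<forall>k. q k < 2) \<and> (\<forall>m. \<not> refutes (Some \<circ> r) q m)"
proof -
  have "(\<forall>m. \<not> refutes (Some \<circ> r) q m) \<longleftrightarrow> (\<forall>k n. \<not> refutes (Some \<circ> r) q (prod_encode (k, n)))"
    by (metis prod_decode_inverse surj_pair)
  also have "\<dots> \<longleftrightarrow> (\<forall>k n. q k = n mod 2 \<longrightarrow> r (prod_encode (k, n)) = 0)"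
    by (auto simp: refutes_def gr0_conv_Suc[symmetric])
  finally show ?thesis
    unfolding LLPO_hat_nonempty_iff by (auto simp: LLPO_hat_def mem_LLPO_iff)
qed

section \<open>Weak Koenig's lemma from the parallelization of LLPO\<close>

text \<open>
  The number \<open>v\<close> stands for the sequence of its binary digits, least significant first, padded by
  zeros.  A node of the binary tree of height \<open>L\<close> is a number \<open>v < 2 ^ L\<close>, and the numbers
  \<open>v + u * 2 ^ L\<close> are its extensions.
\<close>

definition bits :: "nat \<Rightarrow> baire" where
  "bits v i = v div 2 ^ i mod 2"

definition stem :: "baire \<Rightarrow> nat \<Rightarrow> nat" where
  "stem x L = (\<Sum>i<L. x i * 2 ^ i)"

lemma bits_add_mult: "i < k \<Longrightarrow> bits (a + c * 2 ^ k) i = bits a i"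
proof -
  assume "i < k"
  then obtain d where k: "k = i + Suc d"
    by (metis less_iff_Suc_add add_Suc_right)
  have "(a + c * 2 ^ k) div 2 ^ i = a div 2 ^ i + 2 * (c * 2 ^ d)"
    using div_mult_self1[of "2 ^ i :: nat" a "2 * (c * 2 ^ d)"] by (simp add: k power_add ac_simps)
  then show ?thesis
    by (simp add: bits_def)
qed

lemma stem_add: "stem x (L + n) = stem x L + stem (\<lambda>i. x (L + i)) n * 2 ^ L"
  by (induction n) (simp_all add: stem_def algebra_simps power_add)

lemma stem_less: "(\<And>i. x i < 2) \<Longrightarrow> stem x n < 2 ^ n"
proof (induction n)
  case (Suc n)
  have "x n * 2 ^ n \<le> 1 * 2 ^ n"
    using Suc.prems[of n] by (intro mult_right_mono) auto
  with Suc.IH[OF Suc.prems] show ?case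
    unfolding stem_def sum.lessThan_Suc power_Suc by linarith
qed (simp add: stem_def)

lemma bits_stem:
  assumes "\<And>i. x i < 2" "j < L"
  shows "bits (stem x L) j = x j"
proof -
  from assms(2) obtain d where L: "L = Suc j + d"
    by (metis less_iff_Suc_add add_Suc)
  have "bits (stem x L) j = bits (stem x (Suc j)) j"
    unfolding L stem_add by (rule bits_add_mult) simp
  also have "\<dots> = x j"
    using stem_less[of x j] assms(1) by (simp add: bits_def stem_def)
  finally show ?thesis .
qed

text \<open>
  The predicate \<open>R n x\<close> says that the sequence \<open>x\<close> has been refuted by stage \<open>n\<close>; it will
  depend only on the first \<open>n\<close> digits of \<open>x\<close>.  Since \<open>u < 2 ^ n\<close> runs through all possibilities for
  the \<open>n\<close> digits that follow the node, at a dead node every sequence through it is refuted.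
\<close>

definition dead :: "(nat \<Rightarrow> baire \<Rightarrow> bool) \<Rightarrow> nat \<Rightarrow> nat \<Rightarrow> nat \<Rightarrow> bool" where
  "dead R n L v \<longleftrightarrow> (\<forall>u<2 ^ n. R n (bits (v + u * 2 ^ L)))"

text \<open>
  The stage \<open>n\<close> is determined by the child \<open>b\<close>, which keeps the entries of the instance unique.  If
  both children die at the same stage, neither is blamed; their parent is then dead as well.
\<close>

definition dies_first :: "(nat \<Rightarrow> baire \<Rightarrow> bool) \<Rightarrow> nat \<Rightarrow> nat \<Rightarrow> nat \<Rightarrow> nat \<Rightarrow> bool" where
  "dies_first R L v b n \<longleftrightarrow> dead R (Suc n) (Suc L) (v + b * 2 ^ L) \<and>
     \<not> dead R n (Suc L) (v + b * 2 ^ L) \<and> \<not> dead R (Suc n) (Suc L) (v + (1 - b) * 2 ^ L)"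

definition tree_instance :: "(nat \<Rightarrow> baire \<Rightarrow> bool) \<Rightarrow> baire" where
  "tree_instance R m = of_bool (dies_first R (fst (prod_decode (fst (prod_decode m))))
     (snd (prod_decode (fst (prod_decode m)))) (snd (prod_decode m) mod 2) (snd (prod_decode m) div 2))"

primrec descend :: "baire \<Rightarrow> nat \<Rightarrow> nat" where
  "descend h 0 = 0"
| "descend h (Suc L) = descend h L + h (prod_encode (L, descend h L)) * 2 ^ L"

definition branch :: "baire \<Rightarrow> baire" where
  "branch h L = h (prod_encode (L, descend h L))"

lemma descend_eq_stem: "descend h L = stem (branch h) L"
  by (induction L) (simp_all add: stem_def branch_def)

text \<open>
  The condition at stage \<open>0\<close> ensures that a node that dies does so at some stage \<open>Suc n\<close>, which is
  where \<^const>\<open>dies_first\<close> looks for it.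
\<close>

locale refutation_tree =
  fixes R :: "nat \<Rightarrow> baire \<Rightarrow> bool"
  assumes R_0: "\<not> R 0 x"
    and R_mono: "R m x \<Longrightarrow> m \<le> n \<Longrightarrow> R n x"
    and R_local: "(\<And>i. i < n \<Longrightarrow> x i = y i) \<Longrightarrow> R n x \<Longrightarrow> R n y"
begin

text \<open>Only the lowest \<open>n\<close> digits of \<open>u\<close> can matter at stage \<open>n\<close>, so the bound on \<open>u\<close> can be lifted.\<close>

lemma R_bits_low:
  assumes "dead R n L v"
  shows "R n (bits (v + u * 2 ^ L))"
proof -
  have "R n (bits (v + u mod 2 ^ n * 2 ^ L))"
    using assms unfolding dead_def by simp
  moreover have "bits (v + u mod 2 ^ n * 2 ^ L) i = bits (v + u * 2 ^ L) i" if "i < n" for i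
  proof -
    have "v + u * 2 ^ L = v + (u mod 2 ^ n + u div 2 ^ n * 2 ^ n) * 2 ^ L"
      by (simp only: mod_div_mult_eq)
    also have "\<dots> = (v + u mod 2 ^ n * 2 ^ L) + u div 2 ^ n * 2 ^ (n + L)"
      by (simp only: algebra_simps power_add)
    finally have eq: "v + u * 2 ^ L = (v + u mod 2 ^ n * 2 ^ L) + u div 2 ^ n * 2 ^ (n + L)" .
    show ?thesis
      unfolding eq by (rule bits_add_mult[symmetric]) (use that in simp)
  qed
  ultimately show ?thesis
    by (blast intro: R_local)
qed

lemma not_dead_0: "\<not> dead R 0 L v"
  by (simp add: dead_def R_0)

lemma dead_mono: "dead R m L v \<Longrightarrow> m \<le> n \<Longrightarrow> dead R n L v"
  using R_bits_low R_mono unfolding dead_def by blast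

lemma dead_if_children_dead:
  assumes "dead R n (Suc L) v" "dead R n (Suc L) (v + 2 ^ L)"
  shows "dead R n L v"
  unfolding dead_def
proof (intro allI impI)
  fix u :: nat
  have "u = 2 * (u div 2) \<or> u = 1 + 2 * (u div 2)"
    by presburger
  then have "v + u * 2 ^ L = v + u div 2 * 2 ^ Suc L \<or> v + u * 2 ^ L = v + 2 ^ L + u div 2 * 2 ^ Suc L"
  proof
    assume "u = 2 * (u div 2)"
    then have "u * 2 ^ L = 2 * (u div 2) * 2 ^ L" by simp
    then show ?thesis by simp
  next
    assume "u = 1 + 2 * (u div 2)"
    then have "u * 2 ^ L = (1 + 2 * (u div 2)) * 2 ^ L" by simp
    then show ?thesis by (simp add: algebra_simps)
  qed
  then show "R n (bits (v + u * 2 ^ L))"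
    using R_bits_low[OF assms(1), of "u div 2"] R_bits_low[OF assms(2), of "u div 2"] by metis
qed

text \<open>Each component of the instance has at most one nonzero entry, as \<^const>\<open>LLPO\<close> demands.\<close>

lemma dies_first_unique:
  assumes "dies_first R L v b m" "dies_first R L v b' n" "b < 2" "b' < 2"
  shows "b = b' \<and> m = n"
proof (cases "b' = b")
  case True
  then have "\<not> Suc m \<le> n" "\<not> Suc n \<le> m"
    using assms dead_mono unfolding dies_first_def by blast+
  with True show ?thesis by simp
next
  case False
  then have "b' = 1 - b" "b = 1 - b'"
    using assms(3,4) by auto
  then have "\<not> Suc m \<le> Suc n" "\<not> Suc n \<le> Suc m"
    using assms(1,2) dead_mono unfolding dies_first_def by metis+
  then show ?thesis by simp
qed

lemma LLPO_hat_tree_instance: "LLPO_hat (tree_instance R) \<noteq> {}"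
  unfolding LLPO_hat_nonempty_iff
proof (unfold at_most_one_nonzero_def, intro allI impI)
  fix k i j
  assume "tree_instance R (prod_encode (k, i)) \<noteq> 0 \<and> tree_instance R (prod_encode (k, j)) \<noteq> 0"
  then have "i mod 2 = j mod 2 \<and> i div 2 = j div 2"
    by (intro dies_first_unique[of "fst (prod_decode k)" "snd (prod_decode k)"])
      (auto simp: tree_instance_def)
  then show "i = j"
    by (metis mult_div_mod_eq)
qed

text \<open>
  If the selected child died, then at the stage of its death the sibling would be either
  alive, and the answer \<open>b\<close> would be refuted by the instance, or dead, and the node itself would be
  dead.
\<close>

lemma child_alive:
  assumes h: "h \<in> LLPO_hat (tree_instance R)" and alive: "\<And>n. \<not> dead R n L v"
  defines "b \<equiv> h (prod_encode (L, v))"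
  shows "\<not> dead R n (Suc L) (v + b * 2 ^ L)"
proof
  assume "dead R n (Suc L) (v + b * 2 ^ L)"
  define N where "N = (LEAST n. dead R n (Suc L) (v + b * 2 ^ L))"
  have N: "dead R N (Suc L) (v + b * 2 ^ L)"
    unfolding N_def by (rule LeastI) fact
  then obtain m where m: "N = Suc m"
    using not_dead_0 by (cases N) auto
  have "\<not> dead R m (Suc L) (v + b * 2 ^ L)"
    using not_less_Least[of m "\<lambda>n. dead R n (Suc L) (v + b * 2 ^ L)"] m unfolding N_def by simp
  moreover have b: "b < 2"
    using h unfolding mem_LLPO_hat_iff[of h] b_def by blast
  moreover have "\<not> dead R N (Suc L) (v + (1 - b) * 2 ^ L)"
  proof
    assume "dead R N (Suc L) (v + (1 - b) * 2 ^ L)"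
    moreover have "b = 0 \<or> b = 1" using b by auto
    ultimately have "dead R N L v"
      using N dead_if_children_dead[of N L v] by auto
    with alive show False by blast
  qed
  ultimately have "dies_first R L v b m"
    using N unfolding dies_first_def m by blast
  then have "refutes (Some \<circ> tree_instance R) h (prod_encode (prod_encode (L, v), 2 * m + b))"
    using b by (simp add: refutes_def tree_instance_def b_def)
  then show False
    using h unfolding mem_LLPO_hat_iff[of h] by blast
qed

text \<open>
  The unrefuted sequence \<open>x\<close> keeps the root alive, and by the previous lemma all nodes on
  the branch stay alive.  If the branch were refuted at stage \<open>n\<close>, then so would be every sequence
  through its node of height \<open>n\<close>, and this node would be dead.
\<close>

theorem branch_unrefuted:
  assumes x: "\<And>i. x i < 2" "\<And>n. \<not> R n x" and h: "h \<in> LLPO_hat (tree_instance R)"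
  shows "branch h i < 2" "\<not> R n (branch h)"
proof -
  have bit: "branch h i < 2" for i
    using h unfolding mem_LLPO_hat_iff[of h] branch_def by blast
  then show "branch h i < 2" .
  have "\<not> dead R n L (descend h L)" for n L
  proof (induction L arbitrary: n)
    case 0
    show ?case
    proof
      assume "dead R n 0 (descend h 0)"
      then have "R n (bits (stem x n))"
        using R_bits_low[of n 0 0 "stem x n"] by simp
      then have "R n x"
        by (rule R_local[rotated]) (use bits_stem[of x] x(1) in auto)
      with x(2) show False by blast
    qed
  next
    case (Suc L)
    show ?case
      using child_alive[OF h Suc.IH] by simp
  qed
  then have "\<not> dead R n n (stem (branch h) n)"
    by (simp add: descend_eq_stem)
  then obtain u where "\<not> R n (bits (stem (branch h) n + u * 2 ^ n))"
    unfolding dead_def by blast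
  moreover have "bits (stem (branch h) n + u * 2 ^ n) i = branch h i" if "i < n" for i
    using that bit by (simp add: bits_add_mult bits_stem)
  ultimately show "\<not> R n (branch h)"
    using R_local[of n "branch h" "bits (stem (branch h) n + u * 2 ^ n)"] by presburger
qed

end

section \<open>The refutation tree of a composition\<close>

definition even_part :: "baire \<Rightarrow> baire" where
  "even_part x i = x (2 * i)"

definition odd_part :: "baire \<Rightarrow> baire" where
  "odd_part x i = x (2 * i + 1)"

lemma parts_baire_pair [simp]: "even_part (baire_pair p q) = p" "odd_part (baire_pair p q) = q"
  by (auto simp: even_part_def odd_part_def baire_pair_def)

text \<open>
  The even part of \<open>x\<close> is a candidate \<open>q\<close> for the solution of the first instance and the odd part a
  candidate for the solution of the second one.  The approximators \<open>A1\<close>, \<open>A2\<close>, \<open>A3\<close> belong to \<open>K1\<close>,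
  which produces the first instance, to \<open>H1\<close>, which produces a name of the intermediate point
  from \<open>p\<close> and \<open>q\<close>, and to \<open>K2\<close>, which turns that name into the second instance.
\<close>

definition refuted_at ::
  "approximator \<Rightarrow> approximator \<Rightarrow> approximator \<Rightarrow> baire \<Rightarrow> nat \<Rightarrow> baire \<Rightarrow> bool" where
  "refuted_at A1 A2 A3 p s x \<longleftrightarrow> (\<exists>m<s.
     refutes (A1 (initial p s) s) (even_part x) m \<or>
     refutes (A3 (A2 (initial (baire_pair p (even_part x)) s) s) s) (odd_part x) m)"

text \<open>
  Stage \<open>s\<close> inspects entries \<open>m < s\<close> of the instances and hence digits of \<open>x\<close> below \<open>2 * s\<close>;
  the condition \<open>2 * s \<le> n\<close> makes the predicate depend on the first \<open>n\<close> digits only.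
\<close>

definition refuted ::
  "approximator \<Rightarrow> approximator \<Rightarrow> approximator \<Rightarrow> baire \<Rightarrow> nat \<Rightarrow> baire \<Rightarrow> bool" where
  "refuted A1 A2 A3 p n x \<longleftrightarrow> (\<exists>s<n. 2 * s \<le> n \<and> refuted_at A1 A2 A3 p s x)"

lemma refuted_at_local:
  assumes "\<And>i. i < s \<Longrightarrow> p' i = p i" "\<And>i. i < 2 * s \<Longrightarrow> y i = x i"
  shows "refuted_at A1 A2 A3 p' s y = refuted_at A1 A2 A3 p s x"
proof -
  have 1: "initial p' s = initial p s"
    using assms(1) by (auto simp: initial_def)
  have 2: "initial (baire_pair p' (even_part y)) s = initial (baire_pair p (even_part x)) s"
    using assms by (auto simp: initial_def baire_pair_def even_part_def)
  have "even_part y (fst (prod_decode m)) = even_part x (fst (prod_decode m)) \<and>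
      odd_part y (fst (prod_decode m)) = odd_part x (fst (prod_decode m))" if "m < s" for m
  proof -
    have "fst (prod_decode m) \<le> m"
      using le_prod_encode_1[of "fst (prod_decode m)" "snd (prod_decode m)"] by simp
    then show ?thesis
      using assms(2) that by (simp add: even_part_def odd_part_def)
  qed
  then show ?thesis
    unfolding refuted_at_def refutes_def 1 2 by auto
qed

lemma refutation_tree_refuted: "refutation_tree (refuted A1 A2 A3 p)"
proof
  show "\<not> refuted A1 A2 A3 p 0 x" for x
    by (simp add: refuted_def)
  show "refuted A1 A2 A3 p n x" if "refuted A1 A2 A3 p m x" "m \<le> n" for m n x
    using that unfolding refuted_def by (meson le_trans less_le_trans)
  show "refuted A1 A2 A3 p n y" if "\<And>i. i < n \<Longrightarrow> x i = y i" "refuted A1 A2 A3 p n x" for n x y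
    using that refuted_at_local[of _ p p x y] unfolding refuted_def by (metis less_le_trans)
qed

lemma refutes_mono: "refutes r q m \<Longrightarrow> r \<subseteq>\<^sub>m r' \<Longrightarrow> refutes r' q m"
  unfolding refutes_def map_le_def by (metis domI)

lemma initial_le: "initial p s \<subseteq>\<^sub>m Some \<circ> p"
  by (rule initial_map_le) simp

text \<open>Along a true pair of solutions all approximations are sound, so every refutation is genuine.\<close>

lemma not_refuted:
  assumes "approximates A1 K1" "approximates A2 H1" "approximates A3 K2"
    and "K1 p = Some r" "H1 (baire_pair p (even_part x)) = Some s" "K2 s = Some t"
    and "even_part x \<in> LLPO_hat r" "odd_part x \<in> LLPO_hat t"
  shows "\<not> refuted A1 A2 A3 p n x"
proof -
  have le1: "A1 (initial p i) j \<subseteq>\<^sub>m Some \<circ> r" for i j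
    by (rule approximates_sound[OF assms(1), OF assms(4) initial_le])
  have le3: "A3 (A2 (initial (baire_pair p (even_part x)) i) j) k \<subseteq>\<^sub>m Some \<circ> t" for i j k
  proof (rule approximates_sound[OF assms(3), OF assms(6)])
    show "A2 (initial (baire_pair p (even_part x)) i) j \<subseteq>\<^sub>m Some \<circ> s"
      by (rule approximates_sound[OF assms(2), OF assms(5) initial_le])
  qed
  have "\<not> refutes (Some \<circ> r) (even_part x) m" "\<not> refutes (Some \<circ> t) (odd_part x) m" for m
    using assms(7,8) unfolding mem_LLPO_hat_iff[of "even_part x"] mem_LLPO_hat_iff[of "odd_part x"]
    by simp_all
  then have "\<not> refutes (A1 (initial p i) j) (even_part x) m"
    "\<not> refutes (A3 (A2 (initial (baire_pair p (even_part x)) i) j) k) (odd_part x) m" for i j k m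
    using refutes_mono[OF _ le1] refutes_mono[OF _ le3] by metis+
  then show ?thesis
    by (simp add: refuted_def refuted_at_def)
qed

lemma eventually_initial:
  assumes "\<forall>\<^sub>F (o', s) in approximations p. P o' s"
  shows "\<forall>\<^sub>F s in sequentially. P (initial p s) s"
  using eventually_compose_filterlim[OF assms filterlim_initial] by simp

text \<open>
  The even part is shown to be a solution first; only then is \<open>H1\<close> known to be defined, its
  approximations converge, and they can serve as oracles for the approximations of \<open>K2\<close>.
\<close>

lemma solution_if_not_refuted:
  assumes "approximates A1 K1" "approximates A2 H1" "approximates A3 K2"
    and K1: "K1 p = Some r" "LLPO_hat r \<noteq> {}"
    and x: "\<And>i. x i < 2" "\<And>n. \<not> refuted A1 A2 A3 p n x"
  shows "even_part x \<in> LLPO_hat r"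
    and "H1 (baire_pair p (even_part x)) = Some s \<Longrightarrow> K2 s = Some t \<Longrightarrow> LLPO_hat t \<noteq> {} \<Longrightarrow>
      odd_part x \<in> LLPO_hat t"
proof -
  have x2: "\<not> refuted_at A1 A2 A3 p s x" for s
    using x(2)[of "Suc (2 * s)"] unfolding refuted_def by auto
  have "\<not> refutes (Some \<circ> r) (even_part x) m" for m
  proof
    assume m: "refutes (Some \<circ> r) (even_part x) m"
    have "\<forall>\<^sub>F s in sequentially. A1 (initial p s) s m = Some (r m)"
      by (rule eventually_initial[OF approximates_converges[OF assms(1), OF K1(1)]])
    then have "\<forall>\<^sub>F s in sequentially. m < s \<and> A1 (initial p s) s m = Some (r m)"
      by (intro eventually_conj eventually_gt_at_top)
    then obtain s where "m < s" "A1 (initial p s) s m = Some (r m)"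
      by (auto simp: eventually_sequentially)
    then have "refuted_at A1 A2 A3 p s x"
      using m unfolding refuted_at_def refutes_def by auto
    with x2 show False by blast
  qed
  then show "even_part x \<in> LLPO_hat r"
    unfolding mem_LLPO_hat_iff[of "even_part x"] using K1(2) x(1) by (simp add: even_part_def)
  assume H1: "H1 (baire_pair p (even_part x)) = Some s" and K2: "K2 s = Some t" and t: "LLPO_hat t \<noteq> {}"
  let ?P = "baire_pair p (even_part x)"
  have lim: "filterlim (\<lambda>i. (A2 (initial ?P i) i, i)) (approximations s) sequentially"
  proof (rule filterlim_approximations)
    show "\<forall>\<^sub>F i in sequentially. A2 (initial ?P i) i \<subseteq>\<^sub>m Some \<circ> s"
      using approximates_sound[OF assms(2), OF H1 initial_le] by simp
    show "\<forall>\<^sub>F i in sequentially. A2 (initial ?P i) i n = Some (s n)" for n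
      by (rule eventually_initial[OF approximates_converges[OF assms(2), OF H1]])
  qed (rule eventually_ge_at_top)
  have "\<not> refutes (Some \<circ> t) (odd_part x) m" for m
  proof
    assume m: "refutes (Some \<circ> t) (odd_part x) m"
    have "\<forall>\<^sub>F i in sequentially. A3 (A2 (initial ?P i) i) i m = Some (t m)"
      using eventually_compose_filterlim[OF approximates_converges[OF assms(3), OF K2] lim] by simp
    then have "\<forall>\<^sub>F i in sequentially. m < i \<and> A3 (A2 (initial ?P i) i) i m = Some (t m)"
      by (intro eventually_conj eventually_gt_at_top)
    then obtain i where "m < i" "A3 (A2 (initial ?P i) i) i m = Some (t m)"
      by (auto simp: eventually_sequentially)
    then have "refuted_at A1 A2 A3 p i x"
      using m unfolding refuted_at_def refutes_def by auto
    with x2 show False by blast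
  qed
  then show "odd_part x \<in> LLPO_hat t"
    unfolding mem_LLPO_hat_iff[of "odd_part x"] using t x(1) by (simp add: odd_part_def)
qed

section \<open>Closure of reducibility under composition\<close>

text \<open>
  Realizers can be eliminated: since a realizer may return any solution of any instance and
  need not be defined elsewhere, quantifying over all realizers amounts to quantifying over
  all solutions of the one instance that occurs.
\<close>

lemma reducible_to_LLPO_hat_iff:
  "reducible_via C \<delta>X \<delta>Y f baire_rep baire_rep LLPO_hat \<longleftrightarrow>
     (\<exists>H K. C H \<and> C K \<and> (\<forall>p x. \<delta>X p = Some x \<longrightarrow> x \<in> mdom f \<longrightarrow>
        (\<exists>r. K p = Some r \<and> LLPO_hat r \<noteq> {} \<and>
           (\<forall>q\<in>LLPO_hat r. \<exists>s y. H (baire_pair p q) = Some s \<and> \<delta>Y s = Some y \<and> y \<in> f x))))"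
  (is "_ \<longleftrightarrow> (\<exists>H K. C H \<and> C K \<and> ?red H K)")
proof -
  define comp :: "(baire \<rightharpoonup> baire) \<Rightarrow> (baire \<rightharpoonup> baire) \<Rightarrow> (baire \<rightharpoonup> baire) \<Rightarrow> baire \<rightharpoonup> baire"
    where "comp = (\<lambda>H K G p. Option.bind (K p) (\<lambda>r. Option.bind (G r) (\<lambda>q. H (baire_pair p q))))"
  have realizer: "realizer baire_rep baire_rep LLPO_hat G \<longleftrightarrow>
      (\<forall>r. LLPO_hat r \<noteq> {} \<longrightarrow> (\<exists>q. G r = Some q \<and> q \<in> LLPO_hat r))" for G
    by (auto simp: realizer_def baire_rep_def mdom_def)
  have "(\<forall>G. realizer baire_rep baire_rep LLPO_hat G \<longrightarrow> realizer \<delta>X \<delta>Y f (comp H K G)) \<longleftrightarrow> ?red H K" for H K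
  proof
    assume red: "?red H K"
    show "\<forall>G. realizer baire_rep baire_rep LLPO_hat G \<longrightarrow> realizer \<delta>X \<delta>Y f (comp H K G)"
    proof (intro allI impI)
      fix G assume G: "realizer baire_rep baire_rep LLPO_hat G"
      show "realizer \<delta>X \<delta>Y f (comp H K G)"
        unfolding realizer_def
      proof (intro allI impI, elim conjE)
        fix p x assume "\<delta>X p = Some x" "x \<in> mdom f"
        with red obtain r where r: "K p = Some r" "LLPO_hat r \<noteq> {}"
          and H: "\<And>q. q \<in> LLPO_hat r \<Longrightarrow> \<exists>s y. H (baire_pair p q) = Some s \<and> \<delta>Y s = Some y \<and> y \<in> f x"
          by blast
        obtain q where "G r = Some q" "q \<in> LLPO_hat r"
          using G r(2) unfolding realizer by blast
        then show "\<exists>q y. comp H K G p = Some q \<and> \<delta>Y q = Some y \<and> y \<in> f x"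
          using H[of q] r(1) by (simp add: comp_def)
      qed
    qed
  next
    assume all: "\<forall>G. realizer baire_rep baire_rep LLPO_hat G \<longrightarrow> realizer \<delta>X \<delta>Y f (comp H K G)"
    show "?red H K"
    proof (intro allI impI)
      fix p x assume x: "\<delta>X p = Some x" "x \<in> mdom f"
      (* A realizer that is defined on as few points as possible and that can be prescribed
         at one point. *)
      define G0 where "G0 = (\<lambda>r. if LLPO_hat r = {} then None else Some (SOME q. q \<in> LLPO_hat r))"
      have some: "(SOME q. q \<in> LLPO_hat r) \<in> LLPO_hat r" if "LLPO_hat r \<noteq> {}" for r
        using that by (simp add: some_in_eq)
      have G0: "realizer baire_rep baire_rep LLPO_hat G0"
        using some unfolding realizer by (auto simp: G0_def)
      have run: "\<exists>s y. comp H K G p = Some s \<and> \<delta>Y s = Some y \<and> y \<in> f x"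
        if "realizer baire_rep baire_rep LLPO_hat G" for G
        using all that x unfolding realizer_def[of \<delta>X] by blast
      from run[OF G0] obtain r where r: "K p = Some r" "LLPO_hat r \<noteq> {}"
        by (auto simp: comp_def G0_def bind_eq_Some_conv split: if_splits)
      have "\<exists>s y. H (baire_pair p q) = Some s \<and> \<delta>Y s = Some y \<and> y \<in> f x" if q: "q \<in> LLPO_hat r" for q
      proof -
        have "realizer baire_rep baire_rep LLPO_hat (G0(r \<mapsto> q))"
          using G0 q unfolding realizer by auto
        from run[OF this] show ?thesis
          by (simp add: comp_def r(1))
      qed
      with r show "\<exists>r. K p = Some r \<and> LLPO_hat r \<noteq> {} \<and>
          (\<forall>q\<in>LLPO_hat r. \<exists>s y. H (baire_pair p q) = Some s \<and> \<delta>Y s = Some y \<and> y \<in> f x)"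
        by blast
    qed
  qed
  then show ?thesis
    unfolding reducible_via_def comp_def by simp
qed

lemma computable_even_part: "computable (\<lambda>u. Some (even_part u))"
  unfolding even_part_def by (intro computable_total_rec total_rec_arith) auto

lemma computable_odd_part: "computable (\<lambda>u. Some (odd_part u))"
  unfolding odd_part_def by (intro computable_total_rec total_rec_arith) auto

lemma computable_branch: "computable (\<lambda>u. Some (branch u))"
proof -
  have descend: "descend h L = rec_nat 0 (\<lambda>i v. v + h (prod_encode (i, v)) * 2 ^ i) L" for h L
    by (induction L) simp_all
  show ?thesis
    unfolding branch_def descend
    by (intro computable_total_rec total_rec_arith total_rec_prim) auto
qed

text \<open>
  The classes of reduction functions that the argument covers.  The set \<open>\<A>\<close> of approximators
  is a parameter because the instance has to lie in the class again: for computable functions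
  only approximators given by programs will do.
\<close>

locale reduction_class =
  fixes C :: "(baire \<rightharpoonup> baire) \<Rightarrow> bool" and \<A> :: "approximator set"
  assumes class_bind: "C F \<Longrightarrow> C G \<Longrightarrow> C (\<lambda>p. Option.bind (F p) G)"
    and class_pair: "C F \<Longrightarrow> C G \<Longrightarrow> C (pair_partial F G)"
    and class_computable: "computable F \<Longrightarrow> C F"
    and class_approximates: "C F \<Longrightarrow> \<exists>A\<in>\<A>. approximates A F"
    and class_tree_instance: "A1 \<in> \<A> \<Longrightarrow> A2 \<in> \<A> \<Longrightarrow> A3 \<in> \<A> \<Longrightarrow>
      C (\<lambda>p. Some (tree_instance (refuted A1 A2 A3 p)))"
begin

text \<open>
  The new \<open>K\<close> maps \<open>p\<close> to the instance of weak Koenig's lemma for the refutation tree, and the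
  new \<open>H\<close> reads off the branch, applies \<open>H1\<close> to \<open>p\<close> and the even part of the branch, and
  then \<open>H2\<close> to the result and the odd part.
\<close>

theorem reducible_mcomp:
  assumes "reducible_via C \<delta>X \<delta>Y f baire_rep baire_rep LLPO_hat"
    and "reducible_via C \<delta>Y \<delta>Z g baire_rep baire_rep LLPO_hat"
  shows "reducible_via C \<delta>X \<delta>Z (mcomp g f) baire_rep baire_rep LLPO_hat"
proof -
  obtain H1 K1 where C1: "C H1" "C K1"
    and f: "\<And>p x. \<delta>X p = Some x \<Longrightarrow> x \<in> mdom f \<Longrightarrow> \<exists>r. K1 p = Some r \<and> LLPO_hat r \<noteq> {} \<and>
      (\<forall>q\<in>LLPO_hat r. \<exists>s y. H1 (baire_pair p q) = Some s \<and> \<delta>Y s = Some y \<and> y \<in> f x)"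
    using assms(1) unfolding reducible_to_LLPO_hat_iff by auto
  obtain H2 K2 where C2: "C H2" "C K2"
    and g: "\<And>p x. \<delta>Y p = Some x \<Longrightarrow> x \<in> mdom g \<Longrightarrow> \<exists>r. K2 p = Some r \<and> LLPO_hat r \<noteq> {} \<and>
      (\<forall>q\<in>LLPO_hat r. \<exists>s y. H2 (baire_pair p q) = Some s \<and> \<delta>Z s = Some y \<and> y \<in> g x)"
    using assms(2) unfolding reducible_to_LLPO_hat_iff by auto
  obtain A1 A2 A3 where A: "A1 \<in> \<A>" "A2 \<in> \<A>" "A3 \<in> \<A>"
    and ap: "approximates A1 K1" "approximates A2 H1" "approximates A3 K2"
    using class_approximates C1 C2(2) by metis
  define K where "K = (\<lambda>p. Some (tree_instance (refuted A1 A2 A3 p)))"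
  define X where "X = (\<lambda>u. Option.bind (Some (odd_part u)) (\<lambda>h. Some (branch h)))"
  define Q where "Q = (\<lambda>u. Option.bind (X u) (\<lambda>x. Some (even_part x)))"
  define Q' where "Q' = (\<lambda>u. Option.bind (X u) (\<lambda>x. Some (odd_part x)))"
  define F where "F = (\<lambda>u. Option.bind (pair_partial (\<lambda>u. Some (even_part u)) Q u) H1)"
  define H where "H = (\<lambda>u. Option.bind (pair_partial F Q' u) H2)"
  have "C K"
    unfolding K_def using A by (rule class_tree_instance)
  moreover have "C H"
    unfolding H_def F_def Q_def Q'_def X_def
    by (intro class_bind class_pair C1 C2 class_computable[OF computable_even_part]
        class_computable[OF computable_odd_part] class_computable[OF computable_branch])
  moreover have "\<exists>r. K p = Some r \<and> LLPO_hat r \<noteq> {} \<and>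
      (\<forall>h\<in>LLPO_hat r. \<exists>s z. H (baire_pair p h) = Some s \<and> \<delta>Z s = Some z \<and> z \<in> mcomp g f x)"
    if p: "\<delta>X p = Some x" and "x \<in> mdom (mcomp g f)" for p x
  proof -
    have x: "x \<in> mdom f" "f x \<subseteq> mdom g"
      using that(2) by (auto simp: mdom_def mcomp_def split: if_splits)
    obtain r where r: "K1 p = Some r" "LLPO_hat r \<noteq> {}"
      and H1: "\<And>q. q \<in> LLPO_hat r \<Longrightarrow> \<exists>s y. H1 (baire_pair p q) = Some s \<and> \<delta>Y s = Some y \<and> y \<in> f x"
      using f[OF p x(1)] by blast
    interpret refutation_tree "refuted A1 A2 A3 p"
      by (rule refutation_tree_refuted)
    obtain q where q: "q \<in> LLPO_hat r"
      using r(2) by blast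
    obtain s y where s: "H1 (baire_pair p q) = Some s" "\<delta>Y s = Some y" "y \<in> f x"
      using H1[OF q] by blast
    obtain t q' where t: "K2 s = Some t" "q' \<in> LLPO_hat t"
      using g[OF s(2)] s(3) x(2) by blast
    (* Some true pair of solutions exists; this is what keeps the root of the tree alive. *)
    define w where "w = baire_pair q q'"
    have w: "w i < 2" "\<not> refuted A1 A2 A3 p n w" for i n
    proof -
      show "w i < 2"
        using q t(2) unfolding w_def baire_pair_def mem_LLPO_hat_iff[of q] mem_LLPO_hat_iff[of q'] by simp
      show "\<not> refuted A1 A2 A3 p n w"
        using not_refuted[OF ap, OF r(1), of w s t n] by (simp add: w_def s t q)
    qed
    have "\<exists>s z. H (baire_pair p h) = Some s \<and> \<delta>Z s = Some z \<and> z \<in> mcomp g f x"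
      if h: "h \<in> LLPO_hat (tree_instance (refuted A1 A2 A3 p))" for h
    proof -
      note b = branch_unrefuted[OF w h]
      note sol = solution_if_not_refuted[OF ap, OF r, OF b]
      obtain s y where s: "H1 (baire_pair p (even_part (branch h))) = Some s" "\<delta>Y s = Some y" "y \<in> f x"
        using H1[OF sol(1)] by blast
      obtain t where t: "K2 s = Some t" "LLPO_hat t \<noteq> {}"
        and H2: "\<And>q'. q' \<in> LLPO_hat t \<Longrightarrow> \<exists>u z. H2 (baire_pair s q') = Some u \<and> \<delta>Z u = Some z \<and> z \<in> g y"
        using g[OF s(2)] s(3) x(2) by blast
      obtain u z where u: "H2 (baire_pair s (odd_part (branch h))) = Some u" "\<delta>Z u = Some z" "z \<in> g y"
        using H2[OF sol(2)[OF s(1) t]] by blast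
      have "F (baire_pair p h) = Some s"
        by (simp add: F_def Q_def X_def pair_partial_def s(1))
      then have "H (baire_pair p h) = Some u"
        by (simp add: H_def Q'_def X_def pair_partial_def u(1))
      moreover have "z \<in> mcomp g f x"
        using x s(3) u(3) by (auto simp: mcomp_def)
      ultimately show ?thesis
        using u(2) by blast
    qed
    then show ?thesis
      using LLPO_hat_tree_instance by (auto simp: K_def)
  qed
  ultimately show ?thesis
    unfolding reducible_to_LLPO_hat_iff by blast
qed

end

section \<open>The instance for computable and for continuous reductions\<close>

lemma refuted_oracle_local:
  assumes "\<And>i. i < n \<Longrightarrow> p' i = p i"
  shows "refuted A1 A2 A3 p' n = refuted A1 A2 A3 p n"
proof
  fix x
  have "refuted_at A1 A2 A3 p' s x = refuted_at A1 A2 A3 p s x" if "s < n" for s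
    using assms that by (intro refuted_at_local) auto
  then show "refuted A1 A2 A3 p' n x = refuted A1 A2 A3 p n x"
    unfolding refuted_def by blast
qed

text \<open>
  An entry of the instance is decided at a fixed stage, and up to that stage the approximators
  are only ever applied to a finite part of \<open>p\<close>.
\<close>

lemma continuous_tree_instance:
  "continuous_partial (\<lambda>p. Some (tree_instance (refuted A1 A2 A3 p)))"
  unfolding continuous_partial_iff
proof (intro allI impI)
  fix p q m
  assume q: "Some (tree_instance (refuted A1 A2 A3 p)) = Some q"
  define n where "n = snd (prod_decode m) div 2"
  have "tree_instance (refuted A1 A2 A3 p') m = tree_instance (refuted A1 A2 A3 p) m"
    if "\<forall>i<Suc n. p' i = p i" for p'
  proof -
    have "refuted A1 A2 A3 p' (Suc n) = refuted A1 A2 A3 p (Suc n)"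
      "refuted A1 A2 A3 p' n = refuted A1 A2 A3 p n"
      using that by (auto intro!: refuted_oracle_local)
    then show ?thesis
      by (simp add: tree_instance_def dies_first_def dead_def n_def)
  qed
  with q show "\<exists>b. \<forall>p' q'. Some (tree_instance (refuted A1 A2 A3 p')) = Some q' \<longrightarrow>
      (\<forall>i<b. p' i = p i) \<longrightarrow> q' m = q m"
    by blast
qed

lemma total_rec_program_approximator:
  assumes "total_rec 2 (\<lambda>p ys. code (\<Theta> p (ys ! 0) (ys ! 1)))"
    and "total_rec 1 (\<lambda>p ys. S (ys ! 0))"
  shows "total_rec 2 (\<lambda>p ys. code (program_approximator e (\<Theta> p (ys ! 0)) (S (ys ! 0)) (ys ! 1)))"
proof -
  have "total_rec 2 (\<lambda>p ys. code (ev e (\<Theta> p (ys ! 0)) (S (ys ! 0)) (tl ys)))"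
    using total_rec_ev[OF assms, of 1] by (simp add: numeral_2_eq_2)
  then show ?thesis
    by (rule total_rec_cong) (auto simp: program_approximator_def numeral_2_eq_2 length_Suc_conv)
qed

lemma refutes_iff_code:
  "refutes r q m \<longleftrightarrow> 1 < code (r m) \<and> q (fst (prod_decode m)) = snd (prod_decode m) mod 2"
  by (cases "r m") (auto simp: refutes_def gr0_conv_Suc)

lemma total_rec_bits:
  "total_rec k a \<Longrightarrow> total_rec k b \<Longrightarrow> total_rec k (\<lambda>p xs. bits (a p xs) (b p xs))"
  unfolding bits_def by (intro total_rec_arith)

text \<open>
  The composed approximation of the second instance is obtained by applying the closure
  under bounded evaluation twice, with the stage and the number that encodes \<open>x\<close> packed into a
  single parameter.
\<close>

lemma rec_pred_refuted:
  fixes e1 e2 e3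
  defines "R \<equiv> refuted (program_approximator e1) (program_approximator e2) (program_approximator e3)"
  assumes "total_rec k a" "total_rec k b"
  shows "rec_pred k (\<lambda>p xs. R p (a p xs) (bits (b p xs)))"
proof -
  let ?A1 = "program_approximator e1" and ?A2 = "program_approximator e2"
    and ?A3 = "program_approximator e3"
  let ?s = "\<lambda>c. fst (prod_decode c)" and ?x = "\<lambda>c. bits (snd (prod_decode c))"
  let ?O2 = "\<lambda>p c. ?A2 (initial (baire_pair p (even_part (?x c))) (?s c)) (?s c)"
  have s: "total_rec 1 (\<lambda>p ys. ?s (ys ! 0))"
    by (intro total_rec_arith) auto
  have "total_rec 2 (\<lambda>p ys. if ys ! 1 < ys ! 0 then Suc (p (ys ! 1)) else 0)"
    by (intro total_rec_arith) auto
  then have "total_rec 2 (\<lambda>p ys. code (initial p (ys ! 0) (ys ! 1)))"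
    by (rule total_rec_cong) (simp add: initial_def)
  then have 1: "total_rec 2 (\<lambda>p ys. code (?A1 (initial p (ys ! 0)) (ys ! 0) (ys ! 1)))"
    by (rule total_rec_program_approximator) (intro total_rec_nth, simp)
  have "total_rec 2 (\<lambda>p ys. if ys ! 1 < ?s (ys ! 0)
      then Suc (if ys ! 1 mod 2 = 0 then p (ys ! 1 div 2) else ?x (ys ! 0) (2 * (ys ! 1 div 2))) else 0)"
    by (intro total_rec_arith total_rec_bits) auto
  then have "total_rec 2 (\<lambda>p ys. code (initial (baire_pair p (even_part (?x (ys ! 0)))) (?s (ys ! 0)) (ys ! 1)))"
    by (rule total_rec_cong) (simp add: initial_def baire_pair_def even_part_def even_iff_mod_2_eq_zero)
  then have "total_rec 2 (\<lambda>p ys. code (?O2 p (ys ! 0) (ys ! 1)))"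
    by (rule total_rec_program_approximator) (rule s)
  then have 3: "total_rec 2 (\<lambda>p ys. code (?A3 (?O2 p (ys ! 0)) (?s (ys ! 0)) (ys ! 1)))"
    by (rule total_rec_program_approximator) (rule s)
  have 3: "total_rec 3 (\<lambda>p ys. code (?A3 (?A2 (initial (baire_pair p (even_part (bits (ys ! 1)))) (ys ! 0)) (ys ! 0)) (ys ! 0) (ys ! 2)))"
    using total_rec_comp2[where F = "\<lambda>p c m. code (?A3 (?O2 p c) (?s c) m)", OF 3,
        of 3 "\<lambda>p ys. prod_encode (ys ! 0, ys ! 1)" "\<lambda>p ys. ys ! 2"]
    by (simp add: total_rec_prod_encode total_rec_nth)
  note code1 = total_rec_comp2[where F = "\<lambda>p s m. code (?A1 (initial p s) s m)", OF 1]
  note code3 = total_rec_comp3[where F = "\<lambda>p s v m.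
      code (?A3 (?A2 (initial (baire_pair p (even_part (bits v))) s) s) s m)", OF 3]
  have "rec_pred 2 (\<lambda>p ys. refuted_at ?A1 ?A2 ?A3 p (ys ! 0) (bits (ys ! 1)))"
    unfolding refuted_at_def refutes_iff_code even_part_def[of _ "fst _"] odd_part_def
    by (intro total_rec_arith total_rec_bits code1 code3) auto
  note at = total_rec_comp2[where F = "\<lambda>p s v. of_bool (refuted_at ?A1 ?A2 ?A3 p s (bits v))", OF this]
  have "rec_pred 2 (\<lambda>p ys. R p (ys ! 0) (bits (ys ! 1)))"
    unfolding R_def refuted_def by (intro total_rec_arith at) auto
  then show ?thesis
    using assms(2,3) by (rule total_rec_comp2[where F = "\<lambda>p n v. of_bool (R p n (bits v))"])
qed

lemma computable_tree_instance:
  "computable (\<lambda>p. Some (tree_instance (refuted (program_approximator e1)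
     (program_approximator e2) (program_approximator e3) p)))"
proof (rule computable_total_rec)
  let ?R = "refuted (program_approximator e1) (program_approximator e2) (program_approximator e3)"
  have "rec_pred 3 (\<lambda>p ys. dead (?R p) (ys ! 0) (ys ! 1) (ys ! 2))"
    unfolding dead_def by (intro total_rec_arith rec_pred_refuted) auto
  note dead = total_rec_comp3[where F = "\<lambda>p n L v. of_bool (dead (?R p) n L v)", OF this]
  show "total_rec 1 (\<lambda>p ys. tree_instance (?R p) (ys ! 0))"
    unfolding tree_instance_def dies_first_def by (intro total_rec_arith dead) auto
qed

interpretation computable: reduction_class computable "range program_approximator"
proof
  show "computable F \<Longrightarrow> \<exists>A\<in>range program_approximator. approximates A F" for F
    using computable_approximates by blast
  show "computable (\<lambda>p. Some (tree_instance (refuted A1 A2 A3 p)))"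
    if "A1 \<in> range program_approximator" "A2 \<in> range program_approximator"
      "A3 \<in> range program_approximator" for A1 A2 A3
    using that computable_tree_instance by auto
qed (rule computable_bind computable_pair_partial; assumption)+

interpretation continuous: reduction_class continuous_partial UNIV
proof
  show "continuous_partial F \<Longrightarrow> \<exists>A\<in>UNIV. approximates A F" for F
    using continuous_approximates by blast
qed (rule continuous_partial_bind continuous_partial_pair_partial computable_imp_continuous_partial
    continuous_tree_instance; assumption?)+

theorem proposition7p11:
  fixes X :: "'x set" and Y :: "'y set" and Z :: "'z set"
    and \<delta>X :: "baire \<rightharpoonup> 'x" and \<delta>Y :: "baire \<rightharpoonup> 'y" and \<delta>Z :: "baire \<rightharpoonup> 'z"
    and f :: "'x \<Rightarrow> 'y set" and g :: "'y \<Rightarrow> 'z set"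
  assumes "represented_space X \<delta>X" and "represented_space Y \<delta>Y" and "represented_space Z \<delta>Z"
    and "multivalued f X Y" and "multivalued g Y Z"
  shows "(weihrauch_le \<delta>X \<delta>Y f baire_rep baire_rep LLPO_hat \<and>
          weihrauch_le \<delta>Y \<delta>Z g baire_rep baire_rep LLPO_hat \<longrightarrow>
          weihrauch_le \<delta>X \<delta>Z (mcomp g f) baire_rep baire_rep LLPO_hat) \<and>
         (weihrauch_le_continuous \<delta>X \<delta>Y f baire_rep baire_rep LLPO_hat \<and>
          weihrauch_le_continuous \<delta>Y \<delta>Z g baire_rep baire_rep LLPO_hat \<longrightarrow>
          weihrauch_le_continuous \<delta>X \<delta>Z (mcomp g f) baire_rep baire_rep LLPO_hat)"
  using computable.reducible_mcomp continuous.reducible_mcomp by blast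

end
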